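(* Let $\Sigma\subset\mathbb{R}^{n+1}$ be a $C^3$-smooth, strictly convex hypersurface with unit normal field $\nu$ and radii of curvature $(r_i)_{i=1}^n$ of multiplicity $1$. For $i=1,2$ let $S_i:=\mathcal{Y}_i(\Sigma)$ be the focal sheet associated to $r_i$, and assume that $\mathcal{Y}_i$ is a diffeomorphism (onto its image $S_i$). Define $X_i\in\Gamma(T\Sigma)$, $i=1,2$, by $$r_i\overline{\nabla}_{X_i}\nu=X_i\quad\text{and}\quad \mathrm{d}r_i(X_i)=1,$$ so that $X_i$ is a principal vector field of $\Sigma$. Then the sectional curvature $K_1$ of $S_1$ satisfies $$(\mathcal{Y}_1^\ast K_1)(X_1,X_2)=\frac{\mathrm{d}s_{12}(X_1)-1}{(s_{12})^2}.$$
   Context: $\overline\nabla$ is the flat connection on $\mathbb{R}^{n+1}$. The shape operator of $\Sigma$ is $X\mapsto\overline\nabla_X\nu$; the radii of curvature $r_i:\Sigma\to\mathbb{R}$ are the reciprocals of its eigenvalues (the principal curvatures, which are non-zero by strict convexity), so $r_i(q)\overline\nabla_X\nu=X$ for principal directions $X\in T_q\Sigma$ belonging to $r_i$. Multiplicity $1$ means $r_i(q)\neq r_j(q)$ for all $q\in\Sigma$ and $i\ne j$. For each $i$ the map $\mathcal{Y}_i:\Sigma\to\mathbb{R}^{n+1}$ is $\mathcal{Y}_i(q)=q-r_i(q)\nu(q)$, and its image is the focal sheet of $\Sigma$ associated to $r_i$. The astigmatisms are $s_{ij}:\Sigma\to\mathbb{R}$, $s_{ij}(q)=r_i(q)-r_j(q)$.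 The hypersurface $S_1$ carries the metric induced from $\mathbb{R}^{n+1}$; focal sheets are considered in the situation where they are $C^2$-smooth hypersurfaces. $(\mathcal{Y}_1^\ast K_1)(X_1,X_2)$ at $q$ denotes the sectional curvature of $S_1$ at $\mathcal{Y}_1(q)$ of the plane spanned by $\mathrm{d}\mathcal{Y}_1(X_1(q))$ and $\mathrm{d}\mathcal{Y}_1(X_2(q))$. *)

theory Defs
  imports "HOL-Analysis.Analysis"
begin

section \<open>Functions of class $C^k$ and hypersurfaces\<close>

text \<open>Meant for open \<open>U\<close>; in finite dimension, continuity of all iterated directional
  derivatives is the usual $C^k$ condition.\<close>

primrec Ck_on :: "nat \<Rightarrow> 'a::euclidean_space set \<Rightarrow> ('a \<Rightarrow> 'b::real_normed_vector) \<Rightarrow> bool" where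
  "Ck_on 0 U f \<longleftrightarrow> continuous_on U f"
| "Ck_on (Suc k) U f \<longleftrightarrow>
     (\<forall>x\<in>U. f differentiable (at x)) \<and> (\<forall>v. Ck_on k U (\<lambda>x. frechet_derivative f (at x) v))"

text \<open>Embedded hypersurfaces, without boundary, as local regular level sets.\<close>

definition Ck_hypersurface :: "nat \<Rightarrow> 'a::euclidean_space set \<Rightarrow> bool" where
  "Ck_hypersurface k M \<longleftrightarrow>
     (\<forall>p\<in>M. \<exists>U (f :: 'a \<Rightarrow> real). open U \<and> p \<in> U \<and> Ck_on k U f \<and>
        (\<forall>x\<in>U. \<exists>v. frechet_derivative f (at x) v \<noteq> 0) \<and> M \<inter> U = {x \<in> U. f x = 0})"

definition Ck_map :: "nat \<Rightarrow> 'a::euclidean_space set \<Rightarrow> ('a \<Rightarrow> 'b::real_normed_vector) \<Rightarrow> bool" where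
  "Ck_map k M f \<longleftrightarrow>
     (\<forall>p\<in>M. \<exists>U F. open U \<and> p \<in> U \<and> Ck_on k U F \<and> (\<forall>x\<in>M \<inter> U. F x = f x))"

definition Ck_diffeomorphism ::
    "nat \<Rightarrow> 'a::euclidean_space set \<Rightarrow> 'b::euclidean_space set \<Rightarrow> ('a \<Rightarrow> 'b) \<Rightarrow> bool" where
  "Ck_diffeomorphism k M N f \<longleftrightarrow>
     bij_betw f M N \<and> Ck_map k M f \<and> Ck_map k N (the_inv_into M f)"

definition tangent_space :: "'a::euclidean_space set \<Rightarrow> 'a \<Rightarrow> 'a set" where
  "tangent_space M p =
     {v. \<exists>(\<gamma> :: real \<Rightarrow> 'a) e. e > 0 \<and> \<gamma> 0 = p \<and> (\<forall>t\<in>{-e<..<e}. \<gamma> t \<in> M) \<and>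
           (\<gamma> has_vector_derivative v) (at 0)}"

text \<open>The derivative within \<open>M\<close> is determined only on tangent vectors of \<open>M\<close>
  (see \<open>differential_eq\<close> below); it is only ever applied to those. For vector-valued \<open>f\<close>, this is
  also the flat connection of the ambient space, $\overline\nabla_v f$.\<close>

definition differential ::
    "'a::euclidean_space set \<Rightarrow> ('a \<Rightarrow> 'b::real_normed_vector) \<Rightarrow> 'a \<Rightarrow> 'a \<Rightarrow> 'b" where
  "differential M f p v = frechet_derivative f (at p within M) v"

lemma differential_eq:
  assumes D: "(f has_derivative D) (at p within M)" and v: "v \<in> tangent_space M p"
  shows "differential M f p v = D v"
proof -
  obtain \<gamma> :: "real \<Rightarrow> 'a" and e where e: "e > 0" and \<gamma>0: "\<gamma> 0 = p"
    and \<gamma>M: "\<And>t. t \<in> {-e<..<e} \<Longrightarrow> \<gamma> t \<in> M" and \<gamma>': "(\<gamma> has_vector_derivative v) (at 0)"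
    using v unfolding tangent_space_def by blast
  have *: "((f \<circ> \<gamma>) has_vector_derivative G v) (at 0)"
    if G: "(f has_derivative G) (at p within M)" for G
  proof -
    have "\<gamma> ` {-e<..<e} \<subseteq> M" using \<gamma>M by blast
    then have "(f has_derivative G) (at (\<gamma> 0) within \<gamma> ` {-e<..<e})"
      using has_derivative_subset[OF G] \<gamma>0 by simp
    moreover have "(\<gamma> has_derivative (\<lambda>t. t *\<^sub>R v)) (at 0 within {-e<..<e})"
      using \<gamma>' has_derivative_at_withinI unfolding has_vector_derivative_def by blast
    ultimately have "((f \<circ> \<gamma>) has_derivative (G \<circ> (\<lambda>t. t *\<^sub>R v))) (at 0 within {-e<..<e})"
      by (rule diff_chain_within[rotated])
    moreover have "G \<circ> (\<lambda>t. t *\<^sub>R v) = (\<lambda>t. t *\<^sub>R G v)"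
      using has_derivative_linear[OF G] by (auto simp: linear_cmul)
    moreover have "at 0 within {-e<..<e} = at (0::real)"
      using e by (intro at_within_open) auto
    ultimately show ?thesis by (simp add: has_vector_derivative_def)
  qed
  have "(f has_derivative frechet_derivative f (at p within M)) (at p within M)"
    using D differentiableI frechet_derivative_works by blast
  from *[OF this] *[OF D] show ?thesis
    unfolding differential_def by (rule vector_derivative_unique_at)
qed


section \<open>Principal curvatures\<close>

definition unit_normal_field :: "'a::euclidean_space set \<Rightarrow> ('a \<Rightarrow> 'a) \<Rightarrow> bool" where
  "unit_normal_field M \<nu> \<longleftrightarrow>
     continuous_on M \<nu> \<and> (\<forall>q\<in>M. norm (\<nu> q) = 1 \<and> (\<forall>v\<in>tangent_space M q. \<nu> q \<bullet> v = 0))"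

abbreviation (input) shape_operator :: "'a::euclidean_space set \<Rightarrow> ('a \<Rightarrow> 'a) \<Rightarrow> 'a \<Rightarrow> 'a \<Rightarrow> 'a" where
  "shape_operator M \<nu> q v \<equiv> differential M \<nu> q v"

definition principal_curvatures :: "'a::euclidean_space set \<Rightarrow> ('a \<Rightarrow> 'a) \<Rightarrow> 'a \<Rightarrow> real set" where
  "principal_curvatures M \<nu> q =
     {k. \<exists>v\<in>tangent_space M q. v \<noteq> 0 \<and> shape_operator M \<nu> q v = k *\<^sub>R v}"

text \<open>Strict convexity is definiteness of the second fundamental form; either sign is allowed,
  since the choice of the unit normal is free.\<close>

definition strictly_convex_hypersurface :: "'a::euclidean_space set \<Rightarrow> ('a \<Rightarrow> 'a) \<Rightarrow> bool" where
  "strictly_convex_hypersurface M \<nu> \<longleftrightarrow>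
     (\<forall>q\<in>M. (\<forall>v\<in>tangent_space M q - {0}. shape_operator M \<nu> q v \<bullet> v > 0) \<or>
             (\<forall>v\<in>tangent_space M q - {0}. shape_operator M \<nu> q v \<bullet> v < 0))"

definition radii_of_curvature ::
    "nat \<Rightarrow> 'a::euclidean_space set \<Rightarrow> ('a \<Rightarrow> 'a) \<Rightarrow> (nat \<Rightarrow> 'a \<Rightarrow> real) \<Rightarrow> bool" where
  "radii_of_curvature n M \<nu> r \<longleftrightarrow>
     (\<forall>q\<in>M. (\<lambda>i. r i q) ` {1..n} = (\<lambda>k. 1 / k) ` principal_curvatures M \<nu> q)"

definition multiplicity_one :: "nat \<Rightarrow> 'a set \<Rightarrow> (nat \<Rightarrow> 'a \<Rightarrow> real) \<Rightarrow> bool" where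
  "multiplicity_one n M r \<longleftrightarrow>
     (\<forall>q\<in>M. \<forall>i\<in>{1..n}. \<forall>j\<in>{1..n}. i \<noteq> j \<longrightarrow> r i q \<noteq> r j q)"

definition focal_map ::
    "('a::euclidean_space \<Rightarrow> 'a) \<Rightarrow> (nat \<Rightarrow> 'a \<Rightarrow> real) \<Rightarrow> nat \<Rightarrow> 'a \<Rightarrow> 'a" where
  "focal_map \<nu> r i q = q - r i q *\<^sub>R \<nu> q"

definition focal_sheet ::
    "'a::euclidean_space set \<Rightarrow> ('a \<Rightarrow> 'a) \<Rightarrow> (nat \<Rightarrow> 'a \<Rightarrow> real) \<Rightarrow> nat \<Rightarrow> 'a set" where
  "focal_sheet M \<nu> r i = focal_map \<nu> r i ` M"

definition astigmatism :: "(nat \<Rightarrow> 'a \<Rightarrow> real) \<Rightarrow> nat \<Rightarrow> nat \<Rightarrow> 'a \<Rightarrow> real" where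
  "astigmatism r i j q = r i q - r j q"


section \<open>Sectional curvature of the induced metric\<close>

definition tangential :: "'a::euclidean_space set \<Rightarrow> 'a \<Rightarrow> 'a \<Rightarrow> 'a" where
  "tangential M p v = closest_point (tangent_space M p) v"

text \<open>The Levi-Civita connection of the metric induced from the ambient space, for tangent
  vector fields.\<close>

definition levi_civita ::
    "'a::euclidean_space set \<Rightarrow> ('a \<Rightarrow> 'a) \<Rightarrow> ('a \<Rightarrow> 'a) \<Rightarrow> 'a \<Rightarrow> 'a" where
  "levi_civita M X Y p = tangential M p (differential M Y p (X p))"

definition lie_bracket ::
    "'a::euclidean_space set \<Rightarrow> ('a \<Rightarrow> 'a) \<Rightarrow> ('a \<Rightarrow> 'a) \<Rightarrow> 'a \<Rightarrow> 'a" where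
  "lie_bracket M X Y p = differential M Y p (X p) - differential M X p (Y p)"

definition riemann_curvature ::
    "'a::euclidean_space set \<Rightarrow> ('a \<Rightarrow> 'a) \<Rightarrow> ('a \<Rightarrow> 'a) \<Rightarrow> ('a \<Rightarrow> 'a) \<Rightarrow> 'a \<Rightarrow> 'a" where
  "riemann_curvature M X Y Z p =
     levi_civita M X (levi_civita M Y Z) p - levi_civita M Y (levi_civita M X Z) p
     - levi_civita M (lie_bracket M X Y) Z p"

text \<open>Curvature is tensorial, so tangent vectors \<open>u\<close>, \<open>v\<close> at \<open>p\<close> may be extended to tangent fields
  in any way. On a $C^2$ hypersurface the induced metric is only $C^1$ and the second covariant
  derivatives of a general tangent field do not exist. They do exist at \<open>p\<close> for the tangential
  projection of a constant vector \<open>w\<close> tangent at \<open>p\<close>: with a local unit normal \<open>N\<close>, its covariant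
  derivative along \<open>Y\<close> is $-\langle w, N\rangle\,\overline\nabla_Y N$, whose first factor is $C^1$
  and vanishes at \<open>p\<close>, and whose second factor is continuous. Hence this extension.\<close>

definition sectional_curvature :: "'a::euclidean_space set \<Rightarrow> 'a \<Rightarrow> 'a \<Rightarrow> 'a \<Rightarrow> real" where
  "sectional_curvature M p u v =
     (let U = (\<lambda>q. tangential M q u); V = (\<lambda>q. tangential M q v)
      in (riemann_curvature M U V V p \<bullet> u) / ((u \<bullet> u) * (v \<bullet> v) - (u \<bullet> v)\<^sup>2))"

end

theory Submission
  imports Defs
begin

text \<open>Since \<open>d\<Y>\<^sub>i(X\<^sub>i) = -\<nu>\<close>, the hyperplane tangent to the focal sheet \<open>S\<^sub>i\<close> at \<open>\<Y>\<^sub>i(q)\<close> contains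
  \<open>\<nu>(q)\<close>, and its unit normal is the unit vector in the direction of \<open>X\<^sub>i(q)\<close>. Pulling back unit normals
  of \<open>S\<^sub>1\<close> and \<open>S\<^sub>2\<close> therefore gives differentiable unit principal fields \<open>E\<close>, \<open>F\<close> on \<open>\<Sigma>\<close>, parallel
  to \<open>X\<^sub>1\<close>, \<open>X\<^sub>2\<close>, although the \<open>X\<^sub>i\<close> themselves need not be differentiable. By the Gauss equation \<open>K\<^sub>1\<close> is
  expressed by the second fundamental form of \<open>S\<^sub>1\<close>, in which
  only \<open>\<langle>\<nabla>\<^sub>F E, F\<rangle>\<close> is unknown; the Codazzi equation of \<open>\<Sigma>\<close> gives it as
  \<open>d(1/r\<^sub>2)(E) = (1/r\<^sub>1 - 1/r\<^sub>2) \<langle>\<nabla>\<^sub>F E, F\<rangle>\<close>.\<close>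

section \<open>Calculus of $C^k$ functions\<close>

lemma Ck_on_cong:
  assumes "open U" and "\<And>x. x \<in> U \<Longrightarrow> f x = g x"
  shows "Ck_on k U f \<longleftrightarrow> Ck_on k U g"
  using assms(2)
proof (induction k arbitrary: f g)
  case 0
  then show ?case by (simp cong: continuous_on_cong)
next
  case (Suc k)
  have *: "(f has_derivative D) (at x) \<longleftrightarrow> (g has_derivative D) (at x)" if "x \<in> U" for x D
    using has_derivative_transform_within_open[OF _ assms(1) that, of f D UNIV g]
      has_derivative_transform_within_open[OF _ assms(1) that, of g D UNIV f] Suc.prems by auto
  then have "f differentiable (at x) \<longleftrightarrow> g differentiable (at x)" if "x \<in> U" for x
    using that by (simp add: differentiable_def)
  moreover have "Ck_on k U (\<lambda>x. frechet_derivative f (at x) v)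
      \<longleftrightarrow> Ck_on k U (\<lambda>x. frechet_derivative g (at x) v)" for v
    by (rule Suc.IH) (simp add: frechet_derivative_def *)
  ultimately show ?case by simp
qed

lemma Ck_on_subset: "Ck_on k U f \<Longrightarrow> V \<subseteq> U \<Longrightarrow> Ck_on k V f"
  by (induction k arbitrary: f) (auto intro: continuous_on_subset)

lemma Ck_on_Suc_has_derivative:
  assumes "Ck_on (Suc k) U f" and "x \<in> U"
  shows "(f has_derivative frechet_derivative f (at x)) (at x)"
  using assms by (simp add: frechet_derivative_works[symmetric])

text \<open>Lets the inductions below work with the derivative given by a product or chain rule, in
  place of the choice operator \<open>frechet_derivative\<close>.\<close>

lemma Ck_on_SucI:
  assumes "open U" and "\<And>x. x \<in> U \<Longrightarrow> (f has_derivative D x) (at x)"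
    and "\<And>v. Ck_on k U (\<lambda>x. D x v)"
  shows "Ck_on (Suc k) U f"
proof -
  have "Ck_on k U (\<lambda>x. frechet_derivative f (at x) v)" for v
    using assms(3)[of v] Ck_on_cong[OF assms(1), of "\<lambda>x. frechet_derivative f (at x) v" "\<lambda>x. D x v" k]
      frechet_derivative_at[OF assms(2)] by simp
  then show ?thesis using assms(2) by (auto intro: differentiableI)
qed

lemma Ck_on_Suc_imp_continuous_on: "Ck_on (Suc k) U f \<Longrightarrow> continuous_on U f"
  by (auto intro!: continuous_at_imp_continuous_on differentiable_imp_continuous_within)

lemma Ck_on_Suc_imp: "Ck_on (Suc k) U f \<Longrightarrow> Ck_on k U f"
proof (induction k arbitrary: f)
  case 0
  then show ?case using Ck_on_Suc_imp_continuous_on[of 0 U f] by simp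
next
  case (Suc k)
  then show ?case by (metis Ck_on.simps(2))
qed

lemma Ck_on_imp_continuous_on: "Ck_on k U f \<Longrightarrow> continuous_on U f"
  by (cases k) (auto dest: Ck_on_Suc_imp_continuous_on simp del: Ck_on.simps(2))

lemma Ck_on_const: "Ck_on k U (\<lambda>x. c)"
  by (induction k arbitrary: c) auto

lemma Ck_on_bounded_linear:
  assumes "open U" and "bounded_linear L" and "Ck_on k U f"
  shows "Ck_on k U (\<lambda>x. L (f x))"
  using assms(3)
proof (induction k arbitrary: f)
  case 0
  then show ?case
    by (simp add: bounded_linear.continuous_on[OF assms(2)])
next
  case (Suc k)
  show ?case
    by (rule Ck_on_SucI[OF assms(1)
          bounded_linear.has_derivative[OF assms(2) Ck_on_Suc_has_derivative[OF Suc.prems]]])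
      (use Suc in auto)
qed

lemma Ck_on_add:
  assumes "open U" and "Ck_on k U f" and "Ck_on k U g"
  shows "Ck_on k U (\<lambda>x. f x + g x)"
  using assms(2,3)
proof (induction k arbitrary: f g)
  case 0
  then show ?case by (simp add: continuous_on_add)
next
  case (Suc k)
  show ?case
    by (rule Ck_on_SucI[OF assms(1) has_derivative_add[OF
          Ck_on_Suc_has_derivative[OF Suc.prems(1)] Ck_on_Suc_has_derivative[OF Suc.prems(2)]]])
      (use Suc in auto)
qed

lemma Ck_on_sum:
  assumes "open U" and "\<And>i. i \<in> I \<Longrightarrow> Ck_on k U (f i)"
  shows "Ck_on k U (\<lambda>x. \<Sum>i\<in>I. f i x)"
  using assms(2)
  by (induction I rule: infinite_finite_induct) (auto intro: Ck_on_const Ck_on_add[OF assms(1)])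

lemma Ck_on_scaleR:
  fixes f :: "'a::euclidean_space \<Rightarrow> real"
  assumes "open U" and "Ck_on k U f" and "Ck_on k U g"
  shows "Ck_on k U (\<lambda>x. f x *\<^sub>R g x)"
  using assms(2,3)
proof (induction k arbitrary: f g)
  case 0
  then show ?case by (simp add: continuous_on_scaleR)
next
  case (Suc k)
  have D: "Ck_on k U (\<lambda>x. f x *\<^sub>R frechet_derivative g (at x) v + frechet_derivative f (at x) v *\<^sub>R g x)" for v
    by (rule Ck_on_add[OF assms(1) Suc.IH[OF Ck_on_Suc_imp[OF Suc.prems(1)]]
          Suc.IH[OF _ Ck_on_Suc_imp[OF Suc.prems(2)]]])
      (use Suc.prems in simp_all)
  show ?case
    by (rule Ck_on_SucI[OF assms(1) has_derivative_scaleR[OF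
          Ck_on_Suc_has_derivative[OF Suc.prems(1)] Ck_on_Suc_has_derivative[OF Suc.prems(2)]]])
      (assumption | rule D)+
qed

text \<open>Differentiation lowers the exponent by one, so the induction keeps \<open>a\<close>
  arbitrary. The exponent -1/2 later normalizes a gradient.\<close>

lemma Ck_on_powr:
  fixes f :: "'a::euclidean_space \<Rightarrow> real"
  assumes "open U" and "Ck_on k U f" and pos: "\<And>x. x \<in> U \<Longrightarrow> f x > 0"
  shows "Ck_on k U (\<lambda>x. f x powr a)"
  using assms(2)
proof (induction k arbitrary: a)
  case 0
  then show ?case using pos by (auto intro!: continuous_on_powr continuous_on_const) fastforce
next
  case (Suc k)
  have D: "((\<lambda>x. f x powr a) has_derivative
      (\<lambda>v. (a * f x powr (a - 1)) *\<^sub>R frechet_derivative f (at x) v)) (at x)" if "x \<in> U" for x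
    using has_derivative_powr[OF Ck_on_Suc_has_derivative[OF Suc.prems that]
        has_derivative_const[of a] pos[OF that] UNIV_I] pos[OF that]
    by (simp add: powr_diff mult_ac)
  have "Ck_on k U (\<lambda>x. a *\<^sub>R f x powr (a - 1))"
    by (rule Ck_on_bounded_linear[OF assms(1) bounded_linear_scaleR_right
          Suc.IH[OF Ck_on_Suc_imp[OF Suc.prems]]])
  then show ?case
    using Suc.prems by (intro Ck_on_SucI[OF assms(1) D] Ck_on_scaleR[OF assms(1)]) auto
qed

section \<open>Symmetry of second derivatives\<close>

text \<open>The second difference of \<open>f\<close> over a small parallelogram is symmetric in
  \<open>v\<close> and \<open>w\<close>. Two applications of the mean value theorem make it
  \<open>t * t\<close> times a mixed derivative at a nearby point, and continuity lets that point
  tend to \<open>p\<close>.\<close>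

lemma second_derivative_symmetric_real:
  fixes f :: "'a::euclidean_space \<Rightarrow> real"
  assumes "open U" and f: "Ck_on 2 U f" and p: "p \<in> U"
  defines "D \<equiv> \<lambda>v x. frechet_derivative f (at x) v"
  shows "frechet_derivative (D v) (at p) w = frechet_derivative (D w) (at p) v"
proof -
  define D2 where "D2 = (\<lambda>v w x. frechet_derivative (D v) (at x) w)"
  have f1: "(f has_derivative (\<lambda>v. D v x)) (at x)" if "x \<in> U" for x
    using f that unfolding D_def numeral_2_eq_2 by (auto simp: frechet_derivative_works[symmetric])
  have f2: "(D v has_derivative (\<lambda>w. D2 v w x)) (at x)" if "x \<in> U" for x v
    using f that unfolding D_def D2_def numeral_2_eq_2 by (auto simp: frechet_derivative_works[symmetric])
  have cont: "continuous_on U (D2 v w)" for v w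
    using f unfolding D_def D2_def numeral_2_eq_2 by auto
  have line: "((\<lambda>s. g (a + s *\<^sub>R u)) has_real_derivative g' u) (at s)"
    if "(g has_derivative g') (at (a + s *\<^sub>R u))" for g g' and a u :: 'a and s
  proof -
    have "((\<lambda>s. g (a + s *\<^sub>R u)) has_derivative (\<lambda>h. g' (h *\<^sub>R u))) (at s)"
      by (rule has_derivative_compose[where f = "\<lambda>s. a + s *\<^sub>R u" and g = g, OF _ that])
        (auto intro!: derivative_eq_intros)
    then show ?thesis
      unfolding has_field_derivative_def
      using linear_cmul[OF has_derivative_linear[OF that]] by (simp add: mult_commute_abs)
  qed
  obtain d where d: "d > 0" "ball p d \<subseteq> U" using assms(1) p openE by blast
  \<comment> \<open>Grouped as the increment, from \<open>s = 0\<close> to \<open>s = t\<close>, of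
    \<open>f (p + t *\<^sub>R w + s *\<^sub>R v) - f (p + s *\<^sub>R v)\<close>, to which the first
    mean value theorem applies.\<close>
  define \<Delta> where "\<Delta> = (\<lambda>v w t. f (p + t *\<^sub>R v + t *\<^sub>R w) - f (p + t *\<^sub>R v) - (f (p + t *\<^sub>R w) - f p))"
  have mvt: "\<exists>x\<in>cball p (t * (norm v + norm w)). \<Delta> v w t = t * (t * D2 v w x)"
    if t: "0 < t" "t * (norm v + norm w) < d" for v w t
  proof -
    have in_U: "p + a *\<^sub>R v + b *\<^sub>R w \<in> cball p (t * (norm v + norm w)) \<inter> U"
      if "0 \<le> a" "a \<le> t" "0 \<le> b" "b \<le> t" for a b
    proof -
      have "norm (a *\<^sub>R v + b *\<^sub>R w) \<le> a * norm v + b * norm w"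
        by (rule order_trans[OF norm_triangle_ineq]) (use that in auto)
      also have "\<dots> \<le> t * (norm v + norm w)"
        using that by (simp add: distrib_left mult_right_mono add_mono)
      finally have "dist p (p + a *\<^sub>R v + b *\<^sub>R w) \<le> t * (norm v + norm w)"
        using norm_minus_cancel[of "a *\<^sub>R v + b *\<^sub>R w"] by (simp add: dist_norm add.assoc)
      then show ?thesis using d(2) t(2) by (auto simp: subset_eq)
    qed
    have in_U0: "p + a *\<^sub>R v \<in> U" if "0 \<le> a" "a \<le> t" for a
      using in_U[of a 0] that t by simp
    have "((\<lambda>s. f (p + t *\<^sub>R w + s *\<^sub>R v) - f (p + s *\<^sub>R v)) has_real_derivative
        D v (p + t *\<^sub>R w + s *\<^sub>R v) - D v (p + s *\<^sub>R v)) (at s)" if "0 \<le> s" "s \<le> t" for s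
      using in_U[OF that, of t] in_U0[OF that] t
      by (intro derivative_intros line f1) (auto simp: add_ac)
    from MVT2[OF t(1) this] obtain \<xi> where \<xi>: "0 < \<xi>" "\<xi> < t"
      "\<Delta> v w t = t * (D v (p + t *\<^sub>R w + \<xi> *\<^sub>R v) - D v (p + \<xi> *\<^sub>R v))"
      unfolding \<Delta>_def by (auto simp: algebra_simps)
    have "((\<lambda>s. D v (p + \<xi> *\<^sub>R v + s *\<^sub>R w)) has_real_derivative D2 v w (p + \<xi> *\<^sub>R v + s *\<^sub>R w)) (at s)"
      if "0 \<le> s" "s \<le> t" for s
      using in_U[of \<xi> s] \<xi> that by (intro line f2) auto
    from MVT2[OF t(1) this] obtain \<eta> where \<eta>: "0 < \<eta>" "\<eta> < t"
      "D v (p + \<xi> *\<^sub>R v + t *\<^sub>R w) - D v (p + \<xi> *\<^sub>R v) = t * D2 v w (p + \<xi> *\<^sub>R v + \<eta> *\<^sub>R w)"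
      by auto
    have "\<Delta> v w t = t * (t * D2 v w (p + \<xi> *\<^sub>R v + \<eta> *\<^sub>R w))"
      using \<xi>(3) \<eta>(3) by (simp add: add_ac)
    then show ?thesis using in_U[of \<xi> \<eta>] \<xi> \<eta> by auto
  qed
  have le: "\<bar>D2 v w p - D2 w v p\<bar> \<le> 2 * e" if "e > 0" for e
  proof -
    have "continuous (at p) (D2 v w)" "continuous (at p) (D2 w v)"
      using cont assms(1) p continuous_on_eq_continuous_at by blast+
    then obtain d1 d2 where d1: "d1 > 0" "\<And>x. dist x p < d1 \<Longrightarrow> dist (D2 v w x) (D2 v w p) < e"
      and d2: "d2 > 0" "\<And>x. dist x p < d2 \<Longrightarrow> dist (D2 w v x) (D2 w v p) < e"
      unfolding continuous_at_eps_delta dist_norm by (metis \<open>e > 0\<close>)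
    define m where "m = Min {d, d1, d2}"
    \<comment> \<open>The added 1 keeps the denominator positive for \<open>v = w = 0\<close> and
      makes \<open>t * (norm v + norm w)\<close> strictly less than \<open>m\<close>.\<close>
    define t where "t = m / (norm v + norm w + 1)"
    have m: "m > 0" "m \<le> d" "m \<le> d1" "m \<le> d2" using d d1 d2 by (auto simp: m_def)
    have C: "norm v + norm w + 1 > 0" by (simp add: add_nonneg_pos)
    have t: "t > 0" using m C by (simp add: t_def)
    have tm: "t * (norm v + norm w) < m"
      using m C by (simp add: t_def divide_simps add_nonneg_pos mult_less_cancel_left_pos)
    obtain x where x: "x \<in> cball p (t * (norm v + norm w))" "\<Delta> v w t = t * (t * D2 v w x)"
      using mvt[OF t less_le_trans[OF tm m(2)]] by blast
    obtain y where y: "y \<in> cball p (t * (norm w + norm v))" "\<Delta> w v t = t * (t * D2 w v y)"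
      using mvt[OF t, of w v] less_le_trans[OF tm m(2)] by (auto simp: add.commute)
    have "\<Delta> v w t = \<Delta> w v t" by (simp add: \<Delta>_def algebra_simps)
    then have "D2 v w x = D2 w v y" using x y t by simp
    moreover have "\<bar>D2 v w x - D2 v w p\<bar> < e"
      using d1(2)[of x] x tm m by (auto simp: dist_commute dist_real_def)
    moreover have "\<bar>D2 w v y - D2 w v p\<bar> < e"
      using d2(2)[of y] y tm m by (auto simp: dist_commute dist_real_def add.commute)
    ultimately show ?thesis by linarith
  qed
  have "\<bar>D2 v w p - D2 w v p\<bar> \<le> 0"
    by (rule field_le_epsilon) (use le[of "_ / 2"] in fastforce)
  then show ?thesis by (simp add: D2_def)
qed

text \<open>Taking the component along a basis vector commutes with both derivatives, which reduces
  the claim to real-valued functions.\<close>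

lemma second_derivative_symmetric:
  fixes f :: "'a::euclidean_space \<Rightarrow> 'b::euclidean_space"
  assumes "open U" and f: "Ck_on 2 U f" and p: "p \<in> U"
  shows "frechet_derivative (\<lambda>x. frechet_derivative f (at x) v) (at p) w
       = frechet_derivative (\<lambda>x. frechet_derivative f (at x) w) (at p) v"
proof (rule euclidean_eqI)
  fix b :: 'b assume "b \<in> Basis"
  have f1: "(f has_derivative frechet_derivative f (at x)) (at x)" if "x \<in> U" for x
    using f that unfolding numeral_2_eq_2 by (auto simp: frechet_derivative_works[symmetric])
  have f2: "((\<lambda>x. frechet_derivative f (at x) v) has_derivative
      frechet_derivative (\<lambda>x. frechet_derivative f (at x) v) (at p)) (at p)" for v
    using f p unfolding numeral_2_eq_2 by (auto simp: frechet_derivative_works[symmetric])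
  have 1: "frechet_derivative (\<lambda>x. f x \<bullet> b) (at x) v = frechet_derivative f (at x) v \<bullet> b"
    if "x \<in> U" for x v
    by (subst frechet_derivative_at[OF has_derivative_inner_left[OF f1[OF that]], symmetric]) simp
  have 2: "frechet_derivative (\<lambda>x. frechet_derivative (\<lambda>x. f x \<bullet> b) (at x) v) (at p) w
      = frechet_derivative (\<lambda>x. frechet_derivative f (at x) v) (at p) w \<bullet> b" for v w
    by (subst frechet_derivative_at[OF has_derivative_transform_within_open[OF
          has_derivative_inner_left[OF f2] assms(1) p], symmetric])
      (simp_all add: 1)
  have "Ck_on 2 U (\<lambda>x. f x \<bullet> b)"
    by (rule Ck_on_bounded_linear[OF assms(1) bounded_linear_inner_left f])
  from second_derivative_symmetric_real[OF assms(1) this p, of v w]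
  show "frechet_derivative (\<lambda>x. frechet_derivative f (at x) v) (at p) w \<bullet> b
      = frechet_derivative (\<lambda>x. frechet_derivative f (at x) w) (at p) v \<bullet> b"
    by (simp add: 2)
qed

section \<open>Tangent spaces and unit normals of hypersurfaces\<close>

text \<open>For one inclusion, differentiate \<open>f\<close> along a curve. For the other, move
  along \<open>v\<close> and correct in a transversal direction; the intermediate value theorem
  finds a correction for each time separately, which suffices since \<open>tangent_space\<close>
  asks for differentiability at 0 only.\<close>

lemma tangent_space_level_set:
  fixes f :: "'a::euclidean_space \<Rightarrow> real"
  assumes "open U" and p: "p \<in> M" "p \<in> U" and MU: "M \<inter> U = {x \<in> U. f x = 0}"
    and cont: "continuous_on U f" and f': "(f has_derivative f') (at p)" and w0: "f' w0 \<noteq> 0"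
  shows "tangent_space M p = {v. f' v = 0}"
proof (intro equalityI subsetI; clarify)
  fix v assume "v \<in> tangent_space M p"
  then obtain \<gamma> :: "real \<Rightarrow> 'a" and e where e: "e > 0" and \<gamma>0: "\<gamma> 0 = p"
    and \<gamma>M: "\<And>t. t \<in> {-e<..<e} \<Longrightarrow> \<gamma> t \<in> M" and \<gamma>': "(\<gamma> has_vector_derivative v) (at 0)"
    unfolding tangent_space_def by blast
  have "isCont \<gamma> 0"
    using \<gamma>' has_vector_derivative_continuous by blast
  then have "eventually (\<lambda>t. \<gamma> t \<in> U) (nhds 0)"
    using assms(1) p(2) \<gamma>0
    by (metis continuous_at_imp_continuous_at_within eventually_nhds_conv_at isContD topological_tendstoD)
  moreover have "eventually (\<lambda>t. t \<in> {-e<..<e}) (nhds 0)"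
    using e by (intro eventually_nhds_in_open) auto
  ultimately have ev: "eventually (\<lambda>t. f (\<gamma> t) = 0) (nhds 0)"
    by eventually_elim (use \<gamma>M MU in blast)
  have "((\<lambda>t. f (\<gamma> t)) has_derivative (\<lambda>t. f' (t *\<^sub>R v))) (at 0)"
    by (rule has_derivative_compose[where f = \<gamma> and g = f])
      (use \<gamma>' f' \<gamma>0 in \<open>auto simp: has_vector_derivative_def\<close>)
  moreover have "((\<lambda>t. f (\<gamma> t)) has_derivative (\<lambda>t. 0)) (at 0)"
  proof -
    obtain S where "open S" "0 \<in> S" "\<And>t. t \<in> S \<Longrightarrow> f (\<gamma> t) = 0"
      using ev unfolding eventually_nhds by blast
    then show ?thesis
      using has_derivative_transform_within_open[OF has_derivative_const[of 0 "at 0"], of S "\<lambda>t. f (\<gamma> t)"]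
      by auto
  qed
  ultimately have "(\<lambda>t. f' (t *\<^sub>R v)) = (\<lambda>t. 0)"
    by (rule has_derivative_unique)
  from fun_cong[OF this, of 1] show "f' v = 0" by simp
next
  fix v assume v: "f' v = 0"
  have lin: "linear f'" using f' has_derivative_linear by blast
  \<comment> \<open>The transversal direction, scaled so that moving by \<open>s *\<^sub>R w\<close>
    changes \<open>f\<close> by \<open>s\<close> to first order.\<close>
  define w where "w = w0 /\<^sub>R f' w0"
  have w: "f' w = 1" using w0 by (simp add: w_def linear_cmul[OF lin])
  \<comment> \<open>For \<open>\<bar>s\<bar> \<le> \<bar>t\<bar>\<close> the point
    \<open>P t s\<close> lies within \<open>\<bar>t\<bar> * C\<close> of \<open>p\<close>.\<close>
  define C where "C = norm v + norm w + 1"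
  have C: "C > 0" by (simp add: C_def add_nonneg_pos)
  define P where "P = (\<lambda>t s. p + t *\<^sub>R v + s *\<^sub>R w)"
  have est: "\<exists>d>0. \<forall>t s. \<bar>t\<bar> < d \<longrightarrow> \<bar>s\<bar> \<le> \<bar>t\<bar> \<longrightarrow> P t s \<in> U \<and> \<bar>f (P t s) - s\<bar> \<le> e * \<bar>t\<bar>"
    if "e > 0" for e
  proof -
    obtain d1 where d1: "d1 > 0" "ball p d1 \<subseteq> U" using assms(1) p openE by blast
    have "e / C > 0" using that C by simp
    then obtain d2 where d2: "d2 > 0"
      "\<And>y. norm (y - p) < d2 \<Longrightarrow> norm (f y - f p - f' (y - p)) \<le> e / C * norm (y - p)"
      using f' unfolding has_derivative_at_alt by blast
    have "P t s \<in> U \<and> \<bar>f (P t s) - s\<bar> \<le> e * \<bar>t\<bar>"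
      if ts: "\<bar>t\<bar> < min d1 d2 / C" "\<bar>s\<bar> \<le> \<bar>t\<bar>" for t s
    proof -
      have "norm (P t s - p) \<le> \<bar>t\<bar> * norm v + \<bar>s\<bar> * norm w"
        unfolding P_def using norm_triangle_ineq[of "t *\<^sub>R v" "s *\<^sub>R w"] by (simp add: add.assoc)
      also have "\<dots> \<le> \<bar>t\<bar> * C"
        using mult_right_mono[OF ts(2), of "norm w"] by (simp add: C_def algebra_simps)
      finally have n: "norm (P t s - p) \<le> \<bar>t\<bar> * C" .
      also have "\<dots> < min d1 d2" using ts(1) C by (simp add: pos_less_divide_eq)
      finally have "norm (P t s - p) < d1" "norm (P t s - p) < d2" by auto
      then have U: "P t s \<in> U" and "norm (f (P t s) - f p - f' (P t s - p)) \<le> e / C * norm (P t s - p)"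
        using d1(2) d2(2)[of "P t s"] by (auto simp: subset_eq dist_norm norm_minus_commute)
      moreover have "e / C * norm (P t s - p) \<le> e / C * (\<bar>t\<bar> * C)"
        using n \<open>e / C > 0\<close> by (intro mult_left_mono) auto
      moreover have "f' (P t s - p) = s"
        by (simp add: P_def linear_add[OF lin] linear_cmul[OF lin] v w add.assoc)
      moreover have "f p = 0" using MU p by blast
      ultimately show ?thesis using C by simp
    qed
    then show ?thesis using d1(1) d2(1) C by (intro exI[of _ "min d1 d2 / C"]) simp
  qed
  \<comment> \<open>Since \<open>f (P t s) = s + o(t)\<close>, any zero with \<open>\<bar>s\<bar> \<le> \<bar>t\<bar>\<close> automatically has \<open>s = o(t)\<close>.\<close>
  obtain d where d: "d > 0"
    "\<And>t s. \<bar>t\<bar> < d \<Longrightarrow> \<bar>s\<bar> \<le> \<bar>t\<bar> \<Longrightarrow> P t s \<in> U \<and> \<bar>f (P t s) - s\<bar> \<le> 1 / 2 * \<bar>t\<bar>"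
    using est[of "1/2"] by auto
  \<comment> \<open>By the choice of \<open>d\<close>, \<open>f (P t s)\<close> differs from
    \<open>s\<close> by at most half of \<open>\<bar>t\<bar>\<close>, so it is nonpositive at
    \<open>s = -\<bar>t\<bar>\<close> and nonnegative at \<open>s = \<bar>t\<bar>\<close>.\<close>
  have "\<exists>s. \<bar>s\<bar> \<le> \<bar>t\<bar> \<and> f (P t s) = 0" if t: "\<bar>t\<bar> < d" for t
  proof -
    have "continuous_on {-\<bar>t\<bar>..\<bar>t\<bar>} (\<lambda>s. f (P t s))"
      by (rule continuous_on_compose2[OF cont])
        (use d(2)[OF t] in \<open>auto simp: P_def abs_le_iff intro!: continuous_intros\<close>)
    moreover have "\<bar>f (P t (-\<bar>t\<bar>)) - (-\<bar>t\<bar>)\<bar> \<le> 1 / 2 * \<bar>t\<bar>" "\<bar>f (P t \<bar>t\<bar>) - \<bar>t\<bar>\<bar> \<le> 1 / 2 * \<bar>t\<bar>"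
      using d(2)[OF t, of "-\<bar>t\<bar>"] d(2)[OF t, of "\<bar>t\<bar>"] by simp_all
    then have "f (P t (-\<bar>t\<bar>)) \<le> 0" "0 \<le> f (P t \<bar>t\<bar>)" by linarith+
    ultimately obtain s where "-\<bar>t\<bar> \<le> s" "s \<le> \<bar>t\<bar>" "f (P t s) = 0"
      using IVT'[of "\<lambda>s. f (P t s)" "-\<bar>t\<bar>" 0 "\<bar>t\<bar>"] by auto
    then show ?thesis by (auto intro!: exI[of _ s])
  qed
  then obtain s where s: "\<And>t. \<bar>t\<bar> < d \<Longrightarrow> \<bar>s t\<bar> \<le> \<bar>t\<bar>" "\<And>t. \<bar>t\<bar> < d \<Longrightarrow> f (P t (s t)) = 0"
    by metis
  have s0: "s 0 = 0" using s(1)[of 0] d(1) by simp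
  have "(s has_derivative (\<lambda>h. 0)) (at 0)"
    unfolding has_derivative_at_alt
  proof (intro conjI allI impI)
    fix e :: real assume "e > 0"
    then obtain d' where d': "d' > 0"
      "\<And>t s. \<bar>t\<bar> < d' \<Longrightarrow> \<bar>s\<bar> \<le> \<bar>t\<bar> \<Longrightarrow> P t s \<in> U \<and> \<bar>f (P t s) - s\<bar> \<le> e * \<bar>t\<bar>"
      using est by blast
    have "\<bar>s t\<bar> \<le> e * \<bar>t\<bar>" if "\<bar>t\<bar> < min d d'" for t
      using d'(2)[of t "s t"] s[of t] that by auto
    then show "\<exists>d>0. \<forall>y. norm (y - 0) < d \<longrightarrow> norm (s y - s 0 - 0) \<le> e * norm (y - 0)"
      using d(1) d'(1) s0 by (intro exI[of _ "min d d'"]) auto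
  qed simp
  then have "(s has_real_derivative 0) (at 0)"
    unfolding has_field_derivative_def lambda_zero .
  then have "((\<lambda>t. P t (s t)) has_vector_derivative v) (at 0)"
    unfolding P_def by (auto intro!: derivative_eq_intros)
  moreover have "P t (s t) \<in> M" if "t \<in> {-d<..<d}" for t
  proof -
    have "\<bar>t\<bar> < d" using that by auto
    then have "P t (s t) \<in> U" "f (P t (s t)) = 0" using d(2) s by auto
    then show ?thesis using MU by blast
  qed
  ultimately show "v \<in> tangent_space M p"
    unfolding tangent_space_def using d(1) s0
    by (intro CollectI exI[of _ "\<lambda>t. P t (s t)"] exI[of _ d]) (auto simp: P_def)
qed

text \<open>Turns the metric projection in \<open>tangential\<close> into a formula that can be
  differentiated.\<close>

lemma closest_point_hyperplane:
  fixes N :: "'a::euclidean_space"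
  assumes "norm N = 1"
  shows "closest_point {v. N \<bullet> v = 0} x = x - (N \<bullet> x) *\<^sub>R N"
proof (rule closest_point_unique[symmetric])
  have NN: "N \<bullet> N = 1" using assms by (simp add: norm_eq_1)
  then show "x - (N \<bullet> x) *\<^sub>R N \<in> {v. N \<bullet> v = 0}" by (simp add: inner_diff_right)
  show "\<forall>z\<in>{v. N \<bullet> v = 0}. dist x (x - (N \<bullet> x) *\<^sub>R N) \<le> dist x z"
  proof clarify
    fix z assume "N \<bullet> z = 0"
    then have "\<bar>N \<bullet> x\<bar> = \<bar>N \<bullet> (x - z)\<bar>" by (simp add: inner_diff_right)
    also have "\<dots> \<le> norm (x - z)" using Cauchy_Schwarz_ineq2[of N "x - z"] assms by simp
    finally show "dist x (x - (N \<bullet> x) *\<^sub>R N) \<le> dist x z" using assms by (simp add: dist_norm)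
  qed
qed (auto simp: convex_hyperplane closed_hyperplane)

lemma frechet_derivative_unit_field_orthogonal:
  assumes "open U" and "x \<in> U" and "\<And>y. y \<in> U \<Longrightarrow> norm (N y) = 1"
    and N: "(N has_derivative D) (at x)"
  shows "D v \<bullet> N x = 0"
proof -
  have "((\<lambda>y. N y \<bullet> N y) has_derivative (\<lambda>v. N x \<bullet> D v + D v \<bullet> N x)) (at x)"
    using has_derivative_inner[OF N N] .
  moreover have "((\<lambda>y. N y \<bullet> N y) has_derivative (\<lambda>v. 0)) (at x)"
    by (rule has_derivative_transform_within_open[OF has_derivative_const assms(1,2)])
      (use assms(3) in \<open>simp add: norm_eq_1\<close>)
  ultimately have "(\<lambda>v. N x \<bullet> D v + D v \<bullet> N x) = (\<lambda>v. 0)"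
    by (rule has_derivative_unique)
  from fun_cong[OF this, of v] show ?thesis by (simp add: inner_commute)
qed

text \<open>\<open>N\<close> is the normalized gradient of a local defining function, at the cost of
  one derivative. On tangent vectors its derivative is a multiple of the Hessian, hence
  symmetric.\<close>

lemma Ck_hypersurface_unit_normal:
  fixes M :: "'a::euclidean_space set"
  assumes "Ck_hypersurface (Suc (Suc k)) M" and "p \<in> M"
  obtains U N where "open U" "p \<in> U" "Ck_on (Suc k) U N"
    "\<And>x. x \<in> U \<Longrightarrow> norm (N x) = 1"
    "\<And>q. q \<in> M \<inter> U \<Longrightarrow> tangent_space M q = {v. N q \<bullet> v = 0}"
    "\<And>q v w. q \<in> M \<inter> U \<Longrightarrow> v \<in> tangent_space M q \<Longrightarrow> w \<in> tangent_space M q \<Longrightarrow>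
       frechet_derivative N (at q) v \<bullet> w = frechet_derivative N (at q) w \<bullet> v"
proof -
  obtain U and f :: "'a \<Rightarrow> real" where U: "open U" "p \<in> U" and f: "Ck_on (Suc (Suc k)) U f"
    and reg: "\<And>x. x \<in> U \<Longrightarrow> \<exists>v. frechet_derivative f (at x) v \<noteq> 0"
    and MU: "M \<inter> U = {x \<in> U. f x = 0}"
    using assms unfolding Ck_hypersurface_def by meson
  define D where "D = (\<lambda>v x. frechet_derivative f (at x) v)"
  define G where "G = (\<lambda>x. \<Sum>b\<in>Basis. D b x *\<^sub>R b)"
  define h where "h = (\<lambda>x. (G x \<bullet> G x) powr (-1/2))"
  define N where "N = (\<lambda>x. h x *\<^sub>R G x)"
  have f1: "(f has_derivative (\<lambda>v. D v x)) (at x)" if "x \<in> U" for x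
    using Ck_on_Suc_has_derivative[OF f that] by (simp add: D_def)
  have D: "Ck_on (Suc k) U (D v)" for v using f unfolding D_def by auto
  have GD: "G x \<bullet> v = D v x" if "x \<in> U" for x v
    using Linear_Algebra.linear_componentwise[OF has_derivative_linear[OF f1[OF that]], of v 1]
    by (simp add: G_def inner_sum_left inner_sum_right inner_commute mult.commute)
  have G0: "G x \<bullet> G x > 0" if x: "x \<in> U" for x
  proof -
    obtain v where "G x \<bullet> v \<noteq> 0" using reg[OF x] by (auto simp: GD[OF x] D_def)
    then show ?thesis by force
  qed
  have G: "Ck_on (Suc k) U G"
    unfolding G_def
    by (intro Ck_on_sum[OF U(1)] Ck_on_bounded_linear[OF U(1) bounded_linear_scaleR_left D])
  have "Ck_on (Suc k) U (\<lambda>x. \<Sum>b\<in>Basis. D b x *\<^sub>R D b x)"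
    by (intro Ck_on_sum Ck_on_scaleR U(1) D)
  moreover have "(\<lambda>x. \<Sum>b\<in>Basis. D b x *\<^sub>R D b x) = (\<lambda>x. G x \<bullet> G x)"
    unfolding G_def by (subst euclidean_inner) simp
  ultimately have h: "Ck_on (Suc k) U h"
    unfolding h_def using G0 by (intro Ck_on_powr[OF U(1)]) simp_all
  have N: "Ck_on (Suc k) U N"
    unfolding N_def by (rule Ck_on_scaleR[OF U(1) h G])
  have h0: "h x > 0" if "x \<in> U" for x using G0[OF that] by (simp add: h_def)
  have "norm (N x) = 1" if "x \<in> U" for x
    using G0[OF that]
    by (simp add: N_def h_def powr_minus powr_half_sqrt norm_eq_sqrt_inner[symmetric])
  moreover have tan: "tangent_space M q = {v. N q \<bullet> v = 0}" if q: "q \<in> M \<inter> U" for q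
  proof -
    obtain w where "D w q \<noteq> 0" using reg q by (auto simp: D_def)
    from tangent_space_level_set[OF U(1) _ _ MU Ck_on_imp_continuous_on[OF f] f1 this] q
    have "tangent_space M q = {v. D v q = 0}" by auto
    also have "\<dots> = {v. N q \<bullet> v = 0}"
      using q h0[of q] GD[of q] by (simp add: N_def)
    finally show ?thesis .
  qed
  moreover have "frechet_derivative N (at q) v \<bullet> w = frechet_derivative N (at q) w \<bullet> v"
    if q: "q \<in> M \<inter> U" and v: "v \<in> tangent_space M q" and w: "w \<in> tangent_space M q" for q v w
  proof -
    have qU: "q \<in> U" using q by auto
    \<comment> \<open>The term from differentiating the factor \<open>h\<close> is a multiple of the
      gradient, so it drops out against tangent vectors.\<close>
    have "(N has_derivative (\<lambda>v. h q *\<^sub>R frechet_derivative G (at q) v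
        + frechet_derivative h (at q) v *\<^sub>R G q)) (at q)"
      unfolding N_def using Ck_on_Suc_has_derivative[OF h qU] Ck_on_Suc_has_derivative[OF G qU]
      by (rule has_derivative_scaleR)
    then have 1: "frechet_derivative N (at q) v = h q *\<^sub>R frechet_derivative G (at q) v
        + frechet_derivative h (at q) v *\<^sub>R G q" for v
      by (simp add: frechet_derivative_at[symmetric])
    \<comment> \<open>Derivatives of the gradient are second derivatives of \<open>f\<close>, so
      symmetry of the Hessian applies to them.\<close>
    have 2: "frechet_derivative (D w) (at q) v = frechet_derivative G (at q) v \<bullet> w" for v w
      by (subst frechet_derivative_at[OF has_derivative_transform_within_open[OF
            has_derivative_inner_left[OF Ck_on_Suc_has_derivative[OF G qU], of w] U(1) qU],
            of "D w", symmetric]) (simp_all add: GD)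
    have "Ck_on 2 U f"
      using f
    proof (induction k)
      case (Suc k)
      then show ?case using Ck_on_Suc_imp[OF Suc.prems] by iprover
    qed (simp only: numeral_2_eq_2)
    then have "frechet_derivative G (at q) v \<bullet> w = frechet_derivative G (at q) w \<bullet> v"
      using second_derivative_symmetric_real[OF U(1) _ qU, of f v w]
      unfolding 2[symmetric] D_def by simp
    moreover have "G q \<bullet> v = 0" "G q \<bullet> w = 0"
      using v w tan[OF q] h0[OF qU] by (auto simp: N_def)
    ultimately show ?thesis by (simp add: 1 inner_add_left)
  qed
  ultimately show ?thesis using that[OF U N] by blast
qed

section \<open>The Gauss equation\<close>

lemma has_derivative_differential:
  "f differentiable (at p within M) \<Longrightarrow> (f has_derivative differential M f p) (at p within M)"
  unfolding differential_def by (simp add: frechet_derivative_works[symmetric])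

text \<open>Used to compute the differential of \<open>g\<close> from an extension or an explicit
  formula that agrees with it only on \<open>M\<close> near \<open>p\<close>.\<close>

lemma differential_eq_transform:
  assumes "(f has_derivative D) (at p within M)" and "open U" "p \<in> U" "p \<in> M"
    and "\<And>x. x \<in> M \<inter> U \<Longrightarrow> f x = g x" and "v \<in> tangent_space M p"
  shows "differential M g p v = D v"
proof -
  obtain d where "d > 0" "ball p d \<subseteq> U" using assms(2,3) openE by blast
  then have "(g has_derivative D) (at p within M)"
    by (intro has_derivative_transform_within[OF assms(1) _ assms(4)])
      (use assms(5) in \<open>auto simp: subset_eq dist_commute\<close>)
  then show ?thesis using assms(6) by (rule differential_eq)
qed

lemma differential_compose:
  assumes f: "f differentiable (at p within M)" and "f ` M \<subseteq> K"
    and g: "(g has_derivative D) (at (f p) within K)" and v: "v \<in> tangent_space M p"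
  shows "differential M (\<lambda>x. g (f x)) p v = D (differential M f p v)"
  by (rule differential_eq[OF _ v], rule has_derivative_in_compose[OF has_derivative_differential[OF f]])
    (rule has_derivative_subset[OF g assms(2)])

text \<open>The image under \<open>f\<close> of a curve in \<open>M\<close> is a curve in
  \<open>K\<close>.\<close>

lemma differential_in_tangent_space:
  assumes f: "f differentiable (at p within M)" and "f ` M \<subseteq> K" and v: "v \<in> tangent_space M p"
  shows "differential M f p v \<in> tangent_space K (f p)"
proof -
  obtain \<gamma> :: "real \<Rightarrow> _" and e where e: "e > 0" and \<gamma>0: "\<gamma> 0 = p"
    and \<gamma>M: "\<And>t. t \<in> {-e<..<e} \<Longrightarrow> \<gamma> t \<in> M" and \<gamma>': "(\<gamma> has_vector_derivative v) (at 0)"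
    using v unfolding tangent_space_def by blast
  have I: "at 0 within {-e<..<e} = at (0::real)"
    using e by (intro at_within_open) auto
  have "((\<lambda>t. f (\<gamma> t)) has_derivative (\<lambda>t. differential M f p (t *\<^sub>R v))) (at 0 within {-e<..<e})"
  proof (rule has_derivative_in_compose[where f = \<gamma>])
    show "(\<gamma> has_derivative (\<lambda>t. t *\<^sub>R v)) (at 0 within {-e<..<e})"
      using \<gamma>' by (simp add: has_vector_derivative_def I)
    show "(f has_derivative differential M f p) (at (\<gamma> 0) within \<gamma> ` {-e<..<e})"
      using has_derivative_subset[OF has_derivative_differential[OF f]] \<gamma>M \<gamma>0 by blast
  qed
  then have "((\<lambda>t. f (\<gamma> t)) has_vector_derivative differential M f p v) (at 0)"
    unfolding has_vector_derivative_def I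
    by (simp add: linear_cmul[OF has_derivative_linear[OF has_derivative_differential[OF f]]])
  then show ?thesis
    unfolding tangent_space_def using e \<gamma>0 \<gamma>M assms(2)
    by (intro CollectI exI[of _ "\<lambda>t. f (\<gamma> t)"] exI[of _ e]) auto
qed

text \<open>A product rule for merely continuous \<open>g\<close>: the remainder
  \<open>h x *\<^sub>R (g x - g p)\<close> is a linearly bounded factor times one tending to 0. It
  yields second covariant derivatives although the derivative of the normal is only
  continuous.\<close>

lemma has_derivative_scaleR_vanishing:
  fixes h :: "'a::real_normed_vector \<Rightarrow> real" and g :: "'a \<Rightarrow> 'b::real_normed_vector"
  assumes h: "(h has_derivative h') (at p within S)" and h0: "h p = 0"
    and g: "continuous (at p within S) g"
  shows "((\<lambda>x. h x *\<^sub>R g x) has_derivative (\<lambda>v. h' v *\<^sub>R g p)) (at p within S)"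
proof -
  have bl: "bounded_linear h'" using h has_derivative_bounded_linear by blast
  obtain B where B: "B > 0" "\<And>y. \<bar>h' y\<bar> \<le> norm y * B"
    using bounded_linear.pos_bounded[OF bl] by (auto simp: mult.commute)
  obtain d1 where d1: "d1 > 0"
    "\<And>y. y \<in> S \<Longrightarrow> norm (y - p) < d1 \<Longrightarrow> norm (h y - h p - h' (y - p)) \<le> 1 * norm (y - p)"
    using h unfolding has_derivative_within_alt by (metis zero_less_one)
  \<comment> \<open>\<open>B\<close> bounds the derivative, and the added 1 is the accuracy chosen
    for the linear approximation.\<close>
  have h_le: "\<bar>h y\<bar> \<le> (B + 1) * norm (y - p)" if "y \<in> S" "norm (y - p) < d1" for y
    using d1(2)[OF that] B(2)[of "y - p"] h0 by (simp add: algebra_simps)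
  have "((\<lambda>x. h x *\<^sub>R (g x - g p)) has_derivative (\<lambda>v. 0)) (at p within S)"
    unfolding has_derivative_within_alt
  proof (intro conjI allI impI)
    fix e :: real assume "e > 0"
    then have "e / (B + 1) > 0" using B by simp
    then obtain d2 where d2: "d2 > 0"
      "\<And>y. y \<in> S \<Longrightarrow> dist y p < d2 \<Longrightarrow> dist (g y) (g p) < e / (B + 1)"
      using g unfolding continuous_within_eps_delta by blast
    have "norm (h y *\<^sub>R (g y - g p)) \<le> e * norm (y - p)"
      if y: "y \<in> S" "norm (y - p) < min d1 d2" for y
    proof -
      have "norm (h y *\<^sub>R (g y - g p)) \<le> ((B + 1) * norm (y - p)) * (e / (B + 1))"
        unfolding norm_scaleR real_norm_def
        using h_le[OF y(1)] d2(2)[OF y(1)] y(2) B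
        by (intro mult_mono) (auto simp: dist_norm)
      then show ?thesis using B by (simp add: mult.commute)
    qed
    then show "\<exists>d>0. \<forall>y\<in>S. norm (y - p) < d \<longrightarrow>
        norm (h y *\<^sub>R (g y - g p) - h p *\<^sub>R (g p - g p) - 0) \<le> e * norm (y - p)"
      using d1(1) d2(1) by (intro exI[of _ "min d1 d2"]) auto
  qed simp
  from has_derivative_add[OF has_derivative_scaleR_left[OF h, of "g p"] this]
  show ?thesis by (simp add: scaleR_diff_right)
qed

text \<open>The projection of a constant vector \<open>w\<close> has covariant derivative
  \<open>- (N q \<bullet> w) *\<^sub>R DN q (Y q)\<close> along \<open>Y\<close>. Its scalar factor
  vanishes at \<open>p\<close> for tangent \<open>w\<close>, so a second derivative there acts on
  this factor only and leaves products of entries of the second fundamental form.\<close>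

lemma sectional_curvature_hypersurface:
  fixes M :: "'a::euclidean_space set"
  assumes U: "open U" "p \<in> U" and p: "p \<in> M" and N: "Ck_on 1 U N"
    and unit: "\<And>x. x \<in> U \<Longrightarrow> norm (N x) = 1"
    and tan: "\<And>q. q \<in> M \<inter> U \<Longrightarrow> tangent_space M q = {v. N q \<bullet> v = 0}"
    and sym: "\<And>v w. v \<in> tangent_space M p \<Longrightarrow> w \<in> tangent_space M p \<Longrightarrow>
       frechet_derivative N (at p) v \<bullet> w = frechet_derivative N (at p) w \<bullet> v"
    and uv: "u \<in> tangent_space M p" "v \<in> tangent_space M p"
  defines "A \<equiv> frechet_derivative N (at p)"
  shows "sectional_curvature M p u v =
    ((A u \<bullet> u) * (A v \<bullet> v) - (A u \<bullet> v)\<^sup>2) / ((u \<bullet> u) * (v \<bullet> v) - (u \<bullet> v)\<^sup>2)"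
proof -
  define DN where "DN = (\<lambda>q. frechet_derivative N (at q))"
  define W where "W = (\<lambda>w q. w - (N q \<bullet> w) *\<^sub>R N q)"
  have N1: "(N has_derivative DN q) (at q)" if "q \<in> U" for q
    using N Ck_on_Suc_has_derivative[of 0 U N q] that by (simp add: DN_def)
  have DN_orth: "N q \<bullet> DN q y = 0" if "q \<in> U" for q y
    using frechet_derivative_unit_field_orthogonal[OF U(1) that unit N1[OF that]]
    by (simp add: inner_commute)
  have NN: "N q \<bullet> N q = 1" if "q \<in> U" for q using unit[OF that] by (simp add: norm_eq_1)
  have proj: "tangential M q w = W w q" if "q \<in> M \<inter> U" for q w
    using closest_point_hyperplane[OF unit, of q w] that tan[OF that]
    by (simp add: tangential_def W_def)
  have W_tan: "W w q \<in> tangent_space M q" if "q \<in> M \<inter> U" for q w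
    using that tan[OF that] NN[of q] by (simp add: W_def inner_diff_right)
  have W_p: "W w p = w" if "w \<in> tangent_space M p" for w
    using that tan[of p] p U(2) by (simp add: W_def)
  have dW: "differential M (\<lambda>q. tangential M q w) q y = - (DN q y \<bullet> w) *\<^sub>R N q - (N q \<bullet> w) *\<^sub>R DN q y"
    if q: "q \<in> M \<inter> U" and y: "y \<in> tangent_space M q" for q w y
  proof -
    have N': "(N has_derivative DN q) (at q within M)"
      using q by (auto intro: has_derivative_at_withinI[OF N1])
    have "(W w has_derivative (\<lambda>y. 0 - ((N q \<bullet> w) *\<^sub>R DN q y + (DN q y \<bullet> w) *\<^sub>R N q))) (at q within M)"
      unfolding W_def
      by (rule has_derivative_diff[OF has_derivative_const
            has_derivative_scaleR[OF has_derivative_inner_left[OF N'] N']])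
    then have "differential M (\<lambda>q. tangential M q w) q y
        = 0 - ((N q \<bullet> w) *\<^sub>R DN q y + (DN q y \<bullet> w) *\<^sub>R N q)"
      by (rule differential_eq_transform[OF _ U(1) _ _ _ y]) (use q in \<open>auto simp: proj\<close>)
    then show ?thesis by simp
  qed
  \<comment> \<open>The projection removes the part along \<open>N q\<close>; the other part is
    already tangent, because the derivative of a unit field is orthogonal to the field.\<close>
  have nabla: "levi_civita M Y (\<lambda>q. tangential M q w) q = - (N q \<bullet> w) *\<^sub>R DN q (Y q)"
    if q: "q \<in> M \<inter> U" and y: "Y q \<in> tangent_space M q" for q w Y
  proof -
    have "N q \<bullet> (- (DN q (Y q) \<bullet> w) *\<^sub>R N q - (N q \<bullet> w) *\<^sub>R DN q (Y q)) = - (DN q (Y q) \<bullet> w)"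
      using q DN_orth[of q] NN[of q] by (simp add: inner_diff_right)
    then show ?thesis
      unfolding levi_civita_def dW[OF q y] proj[OF q] W_def by simp
  qed
  have nabla2: "levi_civita M (\<lambda>q. tangential M q z) (levi_civita M (\<lambda>q. tangential M q y) (\<lambda>q. tangential M q w)) p
      = - (A z \<bullet> w) *\<^sub>R A y"
    if w: "w \<in> tangent_space M p" and y: "y \<in> tangent_space M p" and z: "z \<in> tangent_space M p"
    for w y z
  proof -
    \<comment> \<open>An expansion of \<open>DN q (W y q)\<close> in the basis: \<open>Ck_on\<close>
      gives continuity of the derivative only for each fixed direction.\<close>
    define g where "g = (\<lambda>q. \<Sum>b\<in>Basis. (W y q \<bullet> b) *\<^sub>R DN q b)"
    have g: "g q = DN q (W y q)" if "q \<in> U" for q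
    proof -
      interpret linear "DN q" using N1[OF that] has_derivative_linear by blast
      have "DN q (W y q) = DN q (\<Sum>b\<in>Basis. (W y q \<bullet> b) *\<^sub>R b)"
        by (simp only: euclidean_representation)
      then show ?thesis by (simp add: g_def sum scale)
    qed
    have "continuous_on U (W y)"
      unfolding W_def using Ck_on_imp_continuous_on[OF N] by (intro continuous_intros)
    moreover have "continuous_on U (\<lambda>q. DN q b)" for b
      using N by (simp add: DN_def)
    ultimately have "continuous_on U g" unfolding g_def by (intro continuous_intros)
    then have cont: "continuous (at p within M) g"
      using U continuous_on_eq_continuous_at continuous_at_imp_continuous_within by blast
    have "((\<lambda>q. - (N q \<bullet> w)) has_derivative (\<lambda>h. - (A h \<bullet> w))) (at p within M)"
      using has_derivative_at_withinI[OF N1[OF U(2)]]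
      by (auto intro!: derivative_eq_intros simp: A_def DN_def)
    then have "((\<lambda>q. - (N q \<bullet> w) *\<^sub>R g q) has_derivative (\<lambda>h. - (A h \<bullet> w) *\<^sub>R g p)) (at p within M)"
      by (rule has_derivative_scaleR_vanishing[OF _ _ cont]) (use w tan p U(2) in auto)
    moreover have "- (N q \<bullet> w) *\<^sub>R g q = levi_civita M (\<lambda>q. tangential M q y) (\<lambda>q. tangential M q w) q"
      if "q \<in> M \<inter> U" for q
      using nabla[OF that, of "\<lambda>q. tangential M q y" w] W_tan[OF that, of y] g[of q] proj[OF that, of y] that
      by simp
    ultimately have "differential M (levi_civita M (\<lambda>q. tangential M q y) (\<lambda>q. tangential M q w)) p z
        = - (A z \<bullet> w) *\<^sub>R g p"
      by (rule differential_eq_transform[OF _ U p]) (use z in auto)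
    moreover have "g p = A y" using g[OF U(2)] W_p[OF y] by (simp add: A_def DN_def)
    moreover have "tangential M p z = z" using proj[of p z] W_p[OF z] p U(2) by simp
    moreover have "tangential M p (- (A z \<bullet> w) *\<^sub>R A y) = - (A z \<bullet> w) *\<^sub>R A y"
      using proj[of p] p U(2) DN_orth[OF U(2), of y] by (simp add: W_def A_def DN_def)
    ultimately show ?thesis by (simp add: levi_civita_def)
  qed
  \<comment> \<open>At \<open>p\<close> both differentials are multiples of \<open>N p\<close>, with
    coefficients \<open>- (A u \<bullet> v)\<close> and \<open>- (A v \<bullet> u)\<close>, which
    agree by symmetry.\<close>
  have "lie_bracket M (\<lambda>q. tangential M q u) (\<lambda>q. tangential M q v) p = 0"
    using p U(2) uv dW[of p u v] dW[of p v u] W_p tan[of p] sym[OF uv]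
    by (simp add: lie_bracket_def proj DN_def)
  then have "levi_civita M (lie_bracket M (\<lambda>q. tangential M q u) (\<lambda>q. tangential M q v))
      (\<lambda>q. tangential M q v) p = 0"
    using nabla[of p "lie_bracket M (\<lambda>q. tangential M q u) (\<lambda>q. tangential M q v)" v] tan[of p] p U(2)
      linear_0[OF has_derivative_linear[OF N1[OF U(2)]]] by simp
  then have "riemann_curvature M (\<lambda>q. tangential M q u) (\<lambda>q. tangential M q v) (\<lambda>q. tangential M q v) p
      = - (A u \<bullet> v) *\<^sub>R A v + (A v \<bullet> v) *\<^sub>R A u"
    using nabla2[OF uv(2) uv(2) uv(1)] nabla2[OF uv(2) uv(1) uv(2)] by (simp add: riemann_curvature_def)
  then show ?thesis
    using sym[OF uv] by (simp add: sectional_curvature_def A_def inner_add_left inner_diff_left power2_eq_square mult.commute)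
qed

section \<open>The Codazzi equation\<close>

lemma Ck_map_Suc_differentiable:
  assumes "Ck_map (Suc k) M f" and p: "p \<in> M"
  shows "f differentiable (at p within M)"
proof -
  obtain U F where U: "open U" "p \<in> U" and F: "Ck_on (Suc k) U F" and eq: "\<And>x. x \<in> M \<inter> U \<Longrightarrow> F x = f x"
    using assms unfolding Ck_map_def by meson
  obtain d where d: "d > 0" "ball p d \<subseteq> U" using U openE by blast
  have "(F has_derivative frechet_derivative F (at p)) (at p within M)"
    by (rule has_derivative_at_withinI[OF Ck_on_Suc_has_derivative[OF F U(2)]])
  then have "(f has_derivative frechet_derivative F (at p)) (at p within M)"
    by (rule has_derivative_transform_within[OF _ d(1) p])
      (use eq d(2) in \<open>auto simp: subset_eq dist_commute\<close>)
  then show ?thesis by (rule differentiableI)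
qed

text \<open>Apply the chain rule to the inverse composed with \<open>f\<close>, which is the
  identity on \<open>M\<close>.\<close>

lemma Ck_diffeomorphism_differential_inj:
  assumes f: "Ck_diffeomorphism (Suc k) M K f" and p: "p \<in> M" and v: "v \<in> tangent_space M p"
    and 0: "differential M f p v = 0"
  shows "v = 0"
proof -
  let ?g = "the_inv_into M f"
  have bij: "bij_betw f M K" using f by (simp add: Ck_diffeomorphism_def)
  have fd: "f differentiable (at p within M)" and gd: "?g differentiable (at (f p) within K)"
    using f p bij_betwE[OF bij] by (auto simp: Ck_diffeomorphism_def intro: Ck_map_Suc_differentiable)
  have "differential M (\<lambda>x. ?g (f x)) p v = differential K ?g (f p) 0"
    using differential_compose[OF fd _ has_derivative_differential[OF gd] v] 0 bij_betw_imp_surj_on[OF bij]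
    by simp
  also have "\<dots> = 0" using has_derivative_differential[OF gd] has_derivative_linear linear_0 by blast
  finally have "differential M (\<lambda>x. ?g (f x)) p v = 0" .
  moreover have "differential M (\<lambda>x. ?g (f x)) p v = v"
    by (rule differential_eq_transform[OF has_derivative_ident open_UNIV _ p _ v])
      (use bij in \<open>auto simp: bij_betw_def the_inv_into_f_f\<close>)
  ultimately show ?thesis by simp
qed

locale oriented_C3_hypersurface =
  fixes \<Sigma> :: "'a::euclidean_space set" and \<nu> :: "'a \<Rightarrow> 'a"
  assumes C3: "Ck_hypersurface 3 \<Sigma>" and normal: "unit_normal_field \<Sigma> \<nu>"
begin

text \<open>The continuous field \<open>\<nu>\<close> inherits the regularity of the normalized
  gradient: the two differ by a sign, which is continuous and therefore locally constant.\<close>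

lemma local_extension:
  assumes p: "p \<in> \<Sigma>"
  obtains U N where "open U" "p \<in> U" "Ck_on 2 U N" "\<And>x. x \<in> U \<Longrightarrow> norm (N x) = 1"
    "\<And>q. q \<in> \<Sigma> \<inter> U \<Longrightarrow> tangent_space \<Sigma> q = {v. N q \<bullet> v = 0}"
    "\<And>q v w. q \<in> \<Sigma> \<inter> U \<Longrightarrow> v \<in> tangent_space \<Sigma> q \<Longrightarrow> w \<in> tangent_space \<Sigma> q \<Longrightarrow>
       frechet_derivative N (at q) v \<bullet> w = frechet_derivative N (at q) w \<bullet> v"
    "\<And>q. q \<in> \<Sigma> \<inter> U \<Longrightarrow> N q = \<nu> q"
proof -
  have 3: "3 = Suc (Suc 1)" by simp
  obtain U N where U: "open U" "p \<in> U" and N: "Ck_on (Suc 1) U N"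
    and unit: "\<And>x. x \<in> U \<Longrightarrow> norm (N x) = 1"
    and tan: "\<And>q. q \<in> \<Sigma> \<inter> U \<Longrightarrow> tangent_space \<Sigma> q = {v. N q \<bullet> v = 0}"
    and sym: "\<And>q v w. q \<in> \<Sigma> \<inter> U \<Longrightarrow> v \<in> tangent_space \<Sigma> q \<Longrightarrow> w \<in> tangent_space \<Sigma> q \<Longrightarrow>
       frechet_derivative N (at q) v \<bullet> w = frechet_derivative N (at q) w \<bullet> v"
    using Ck_hypersurface_unit_normal[OF C3[unfolded 3] p] by blast
  define c where "c = (\<lambda>q. \<nu> q \<bullet> N q)"
  have \<nu>: "\<nu> q = c q *\<^sub>R N q \<and> \<bar>c q\<bar> = 1" if q: "q \<in> \<Sigma> \<inter> U" for q
  proof -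
    \<comment> \<open>This vector is orthogonal to \<open>N q\<close>, hence tangent, hence
      orthogonal to \<open>\<nu> q\<close> too, and so orthogonal to itself.\<close>
    let ?v = "\<nu> q - c q *\<^sub>R N q"
    have NN: "N q \<bullet> N q = 1" using unit q by (simp add: norm_eq_1)
    have Nv: "N q \<bullet> ?v = 0" using NN by (simp add: c_def inner_diff_right inner_commute)
    then have "\<nu> q \<bullet> ?v = 0" using q normal tan[OF q] by (simp add: unit_normal_field_def)
    then have "?v \<bullet> ?v = 0" using Nv by (simp add: inner_diff_left)
    then have *: "\<nu> q = c q *\<^sub>R N q" by simp
    have "norm (\<nu> q) = 1" using q normal by (simp add: unit_normal_field_def)
    then show ?thesis using * unit[of q] q by (metis IntD2 mult.right_neutral norm_scaleR)
  qed
  have "continuous_on (\<Sigma> \<inter> U) c"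
    unfolding c_def using Ck_on_imp_continuous_on[OF N] normal
    by (intro continuous_intros) (auto simp: unit_normal_field_def intro: continuous_on_subset)
  then obtain d where d: "d > 0" "\<And>q. q \<in> \<Sigma> \<inter> U \<Longrightarrow> dist q p < d \<Longrightarrow> dist (c q) (c p) < 1"
    unfolding continuous_on_iff using p U(2) by (metis IntI zero_less_one)
  \<comment> \<open>Two numbers of absolute value 1 at distance less than 1 are equal.\<close>
  have const: "c q = c p" if "q \<in> \<Sigma> \<inter> U" "dist q p < d" for q
    using d(2)[OF that] \<nu>[OF that(1)] \<nu>[of p] p U(2) by (auto simp: dist_real_def abs_if split: if_splits)
  define V where "V = U \<inter> ball p d"
  have V: "open V" "p \<in> V" "V \<subseteq> U" using U d(1) by (auto simp: V_def)
  have cp: "\<bar>c p\<bar> = 1" using \<nu> p U(2) by blast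
  have D: "frechet_derivative (\<lambda>x. c p *\<^sub>R N x) (at x) v = c p *\<^sub>R frechet_derivative N (at x) v"
    if "x \<in> U" for x v
    by (rule frechet_derivative_at[OF has_derivative_scaleR_right[OF Ck_on_Suc_has_derivative[OF N that]],
          THEN fun_cong, symmetric])
  have "Ck_on 2 V (\<lambda>x. c p *\<^sub>R N x)"
    unfolding numeral_2_eq_2 using Ck_on_subset[OF N V(3)]
    by (intro Ck_on_bounded_linear[OF V(1) bounded_linear_scaleR_right]) simp
  moreover have "c p *\<^sub>R N q = \<nu> q" if "q \<in> \<Sigma> \<inter> V" for q
    using \<nu>[of q] const[of q] that by (auto simp: V_def dist_commute)
  moreover have "tangent_space \<Sigma> q = {v. (c p *\<^sub>R N q) \<bullet> v = 0}" if "q \<in> \<Sigma> \<inter> V" for q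
    using tan[of q] that V(3) cp by auto
  moreover have "frechet_derivative (\<lambda>x. c p *\<^sub>R N x) (at q) v \<bullet> w = frechet_derivative (\<lambda>x. c p *\<^sub>R N x) (at q) w \<bullet> v"
    if "q \<in> \<Sigma> \<inter> V" "v \<in> tangent_space \<Sigma> q" "w \<in> tangent_space \<Sigma> q" for q v w
    using sym[of q v w] that V(3) D[of q] by auto
  moreover have "norm (c p *\<^sub>R N x) = 1" if "x \<in> V" for x
    using unit[of x] cp that V(3) by auto
  ultimately show ?thesis
    using V(1,2) by (intro that[of V "\<lambda>x. c p *\<^sub>R N x"])
qed

section \<open>The shape operator of an oriented hypersurface\<close>

lemma normal_inner [simp]: "q \<in> \<Sigma> \<Longrightarrow> \<nu> q \<bullet> \<nu> q = 1"
  using normal by (simp add: unit_normal_field_def norm_eq_1)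

lemma tangent_space_eq: "q \<in> \<Sigma> \<Longrightarrow> tangent_space \<Sigma> q = {v. \<nu> q \<bullet> v = 0}"
  by (rule local_extension[of q]) auto

lemma normal_differentiable:
  assumes q: "q \<in> \<Sigma>"
  shows "\<nu> differentiable (at q within \<Sigma>)"
proof -
  have "Ck_map (Suc 1) \<Sigma> \<nu>"
    unfolding Ck_map_def
  proof
    fix p assume "p \<in> \<Sigma>"
    then show "\<exists>U F. open U \<and> p \<in> U \<and> Ck_on (Suc 1) U F \<and> (\<forall>x\<in>\<Sigma> \<inter> U. F x = \<nu> x)"
      by (rule local_extension) (metis numeral_2_eq_2 One_nat_def)
  qed
  then show ?thesis using q by (rule Ck_map_Suc_differentiable)
qed

lemma shape_operator_extension:
  assumes "open U" "q \<in> \<Sigma> \<inter> U" "Ck_on 2 U N" "\<And>q. q \<in> \<Sigma> \<inter> U \<Longrightarrow> N q = \<nu> q" "v \<in> tangent_space \<Sigma> q"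
  shows "shape_operator \<Sigma> \<nu> q v = frechet_derivative N (at q) v"
proof -
  have "Ck_on (Suc 1) U N" using assms(3) by (simp add: numeral_2_eq_2)
  then have "(N has_derivative frechet_derivative N (at q)) (at q within \<Sigma>)"
    using assms(2) using has_derivative_at_withinI[OF Ck_on_Suc_has_derivative] by blast
  then show ?thesis
    by (rule differential_eq_transform[where U = U]) (use assms in auto)
qed

lemma shape_operator_symmetric:
  assumes q: "q \<in> \<Sigma>" and v: "v \<in> tangent_space \<Sigma> q" and w: "w \<in> tangent_space \<Sigma> q"
  shows "shape_operator \<Sigma> \<nu> q v \<bullet> w = shape_operator \<Sigma> \<nu> q w \<bullet> v"
proof -
  obtain U N where U: "open U" "q \<in> U" and N: "Ck_on 2 U N" and "\<And>x. x \<in> U \<Longrightarrow> norm (N x) = 1"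
    and "\<And>q. q \<in> \<Sigma> \<inter> U \<Longrightarrow> tangent_space \<Sigma> q = {v. N q \<bullet> v = 0}"
    and sym: "\<And>q v w. q \<in> \<Sigma> \<inter> U \<Longrightarrow> v \<in> tangent_space \<Sigma> q \<Longrightarrow> w \<in> tangent_space \<Sigma> q \<Longrightarrow>
       frechet_derivative N (at q) v \<bullet> w = frechet_derivative N (at q) w \<bullet> v"
    and N\<nu>: "\<And>q. q \<in> \<Sigma> \<inter> U \<Longrightarrow> N q = \<nu> q"
    by (fact local_extension[OF q])
  show ?thesis
    using shape_operator_extension[OF U(1) _ N N\<nu> v] shape_operator_extension[OF U(1) _ N N\<nu> w]
      sym[OF _ v w] q U(2) by simp
qed

lemma differential_inner_constant:
  fixes F G :: "'a \<Rightarrow> 'a"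
  assumes q: "q \<in> \<Sigma>" and W: "open W" "q \<in> W" and F: "F differentiable (at q within \<Sigma>)"
    and G: "G differentiable (at q within \<Sigma>)"
    and FG: "\<And>x. x \<in> \<Sigma> \<inter> W \<Longrightarrow> F x \<bullet> G x = c" and v: "v \<in> tangent_space \<Sigma> q"
  shows "F q \<bullet> differential \<Sigma> G q v + differential \<Sigma> F q v \<bullet> G q = 0"
proof -
  have "differential \<Sigma> (\<lambda>x. c) q v = F q \<bullet> differential \<Sigma> G q v + differential \<Sigma> F q v \<bullet> G q"
    by (rule differential_eq_transform[OF has_derivative_inner[OF has_derivative_differential[OF F]
          has_derivative_differential[OF G]] W q FG v])
  moreover have "differential \<Sigma> (\<lambda>x. c) q v = 0"
    by (rule differential_eq[OF has_derivative_const v])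
  ultimately show ?thesis by simp
qed

lemma shape_operator_tangent:
  assumes q: "q \<in> \<Sigma>" and v: "v \<in> tangent_space \<Sigma> q"
  shows "shape_operator \<Sigma> \<nu> q v \<in> tangent_space \<Sigma> q"
  using differential_inner_constant[OF q open_UNIV _ normal_differentiable[OF q] normal_differentiable[OF q] _ v, of 1] q
  by (simp add: tangent_space_eq inner_commute)

text \<open>Differentiate \<open>\<nu> x \<bullet> F x = 0\<close>: the normal part of the
  derivative of a tangent field involves no derivative of that field.\<close>

lemma differential_tangent_field:
  assumes q: "q \<in> \<Sigma>" and W: "open W" "q \<in> W" and F: "F differentiable (at q within \<Sigma>)"
    and FT: "\<And>x. x \<in> \<Sigma> \<inter> W \<Longrightarrow> F x \<in> tangent_space \<Sigma> x" and v: "v \<in> tangent_space \<Sigma> q"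
  shows "\<nu> q \<bullet> differential \<Sigma> F q v = - (shape_operator \<Sigma> \<nu> q v \<bullet> F q)"
  using differential_inner_constant[OF q W normal_differentiable[OF q] F _ v, of 0] FT tangent_space_eq
  by simp

text \<open>The Codazzi equation, for two principal fields. Both sides of
  \<open>shape_operator F = k F\<close> are differentiated along \<open>E\<close>, both sides of \<open>shape_operator E = l E\<close>
  along \<open>F\<close>; the second derivatives of the normal cancel by symmetry.\<close>

lemma codazzi:
  assumes q: "q \<in> \<Sigma>" and W: "open W" "q \<in> W"
    and E: "E differentiable (at q within \<Sigma>)" and F: "F differentiable (at q within \<Sigma>)"
    and l: "l differentiable (at q within \<Sigma>)" and k: "k differentiable (at q within \<Sigma>)"
    and ET: "\<And>x. x \<in> \<Sigma> \<inter> W \<Longrightarrow> E x \<in> tangent_space \<Sigma> x"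
    and FT: "\<And>x. x \<in> \<Sigma> \<inter> W \<Longrightarrow> F x \<in> tangent_space \<Sigma> x"
    and El: "\<And>x. x \<in> \<Sigma> \<inter> W \<Longrightarrow> shape_operator \<Sigma> \<nu> x (E x) = l x *\<^sub>R E x"
    and Fk: "\<And>x. x \<in> \<Sigma> \<inter> W \<Longrightarrow> shape_operator \<Sigma> \<nu> x (F x) = k x *\<^sub>R F x"
    and EF: "E q \<bullet> F q = 0"
  shows "differential \<Sigma> k q (E q) * (F q \<bullet> F q) = (l q - k q) * (differential \<Sigma> E q (F q) \<bullet> F q)"
proof -
  obtain U N where U: "open U" "q \<in> U" and N: "Ck_on 2 U N" and "\<And>x. x \<in> U \<Longrightarrow> norm (N x) = 1"
    and "\<And>q. q \<in> \<Sigma> \<inter> U \<Longrightarrow> tangent_space \<Sigma> q = {v. N q \<bullet> v = 0}"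
    and sym: "\<And>q v w. q \<in> \<Sigma> \<inter> U \<Longrightarrow> v \<in> tangent_space \<Sigma> q \<Longrightarrow> w \<in> tangent_space \<Sigma> q \<Longrightarrow>
       frechet_derivative N (at q) v \<bullet> w = frechet_derivative N (at q) w \<bullet> v"
    and N\<nu>: "\<And>q. q \<in> \<Sigma> \<inter> U \<Longrightarrow> N q = \<nu> q"
    by (fact local_extension[OF q])
  define D where "D = (\<lambda>x. frechet_derivative N (at x))"
  define D2 where "D2 = (\<lambda>b. frechet_derivative (\<lambda>x. D x b) (at q))"
  have linD: "linear (D x)" if "x \<in> U" for x
    using N that unfolding numeral_2_eq_2 D_def
    by (meson Ck_on_Suc_has_derivative has_derivative_linear)
  have d2: "((\<lambda>x. D x b) has_derivative D2 b) (at q within \<Sigma>)" for b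
    unfolding D2_def D_def
    by (rule has_derivative_at_withinI)
      (use N U(2) in \<open>simp add: numeral_2_eq_2 frechet_derivative_works[symmetric]\<close>)
  have linD2: "linear (D2 b)" for b using d2 has_derivative_linear by blast
  have D_sum: "(\<Sum>b\<in>Basis. (y \<bullet> b) *\<^sub>R D x b) = D x y" if "x \<in> U" for x y
  proof -
    interpret linear "D x" by (rule linD[OF that])
    have "D x y = D x (\<Sum>b\<in>Basis. (y \<bullet> b) *\<^sub>R b)"
      by (simp only: euclidean_representation)
    then show ?thesis by (simp add: sum scale)
  qed
  \<comment> \<open>The second derivative of \<open>N\<close> at \<open>q\<close> as a bilinear map,
    expanded in the basis because \<open>d2\<close> differentiates \<open>D x b\<close> for constant
    \<open>b\<close> only.\<close>
  define B where "B = (\<lambda>y h. \<Sum>b\<in>Basis. (y \<bullet> b) *\<^sub>R D2 b h)"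
  have B_sym: "B y h = B h y" for y h
  proof -
    have "B y h = (\<Sum>b\<in>Basis. \<Sum>c\<in>Basis. ((y \<bullet> b) * (h \<bullet> c)) *\<^sub>R D2 b c)" for y h
    proof -
      have "D2 b h = (\<Sum>c\<in>Basis. (h \<bullet> c) *\<^sub>R D2 b c)" for b
      proof -
        interpret linear "D2 b" by (rule linD2)
        have "D2 b h = D2 b (\<Sum>c\<in>Basis. (h \<bullet> c) *\<^sub>R c)"
          by (simp only: euclidean_representation)
        then show ?thesis by (simp add: sum scale)
      qed
      then show ?thesis by (simp add: B_def scaleR_sum_right)
    qed
    note expand = this
    have "D2 b c = D2 c b" for b c
      using second_derivative_symmetric[OF U(1) N U(2)] by (simp add: D2_def D_def)
    then show ?thesis
      unfolding expand by (subst sum.swap) (simp add: mult.commute)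
  qed
  \<comment> \<open>Both sides of the eigenvalue equation for \<open>G\<close>, differentiated along
    \<open>v\<close>.\<close>
  have product: "m q *\<^sub>R differential \<Sigma> G q v + differential \<Sigma> m q v *\<^sub>R G q
      = B (G q) v + D q (differential \<Sigma> G q v)"
    if G: "G differentiable (at q within \<Sigma>)" and m: "m differentiable (at q within \<Sigma>)"
      and GT: "\<And>x. x \<in> \<Sigma> \<inter> W \<Longrightarrow> G x \<in> tangent_space \<Sigma> x"
      and Gm: "\<And>x. x \<in> \<Sigma> \<inter> W \<Longrightarrow> shape_operator \<Sigma> \<nu> x (G x) = m x *\<^sub>R G x"
      and v: "v \<in> tangent_space \<Sigma> q"
    for G m v
  proof -
    have h1: "((\<lambda>x. \<Sum>b\<in>Basis. (G x \<bullet> b) *\<^sub>R D x b) has_derivative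
        (\<lambda>h. \<Sum>b\<in>Basis. (G q \<bullet> b) *\<^sub>R D2 b h + (differential \<Sigma> G q h \<bullet> b) *\<^sub>R D q b)) (at q within \<Sigma>)"
      by (intro has_derivative_sum has_derivative_scaleR has_derivative_inner_left
          has_derivative_differential[OF G] d2)
    have h2: "(\<Sum>b\<in>Basis. (G x \<bullet> b) *\<^sub>R D x b) = m x *\<^sub>R G x" if "x \<in> \<Sigma> \<inter> (U \<inter> W)" for x
      using shape_operator_extension[OF U(1) _ N N\<nu> GT, of x] Gm[of x] D_sum[of x "G x"] that
      by (simp add: D_def)
    have "differential \<Sigma> (\<lambda>x. m x *\<^sub>R G x) q v
        = (\<Sum>b\<in>Basis. (G q \<bullet> b) *\<^sub>R D2 b v + (differential \<Sigma> G q v \<bullet> b) *\<^sub>R D q b)"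
      by (rule differential_eq_transform[OF h1 open_Int[OF U(1) W(1)] _ q h2 v]) (use U W in auto)
    also have "\<dots> = B (G q) v + D q (differential \<Sigma> G q v)"
      using D_sum[OF U(2)] by (simp add: sum.distrib B_def)
    also have "differential \<Sigma> (\<lambda>x. m x *\<^sub>R G x) q v
        = m q *\<^sub>R differential \<Sigma> G q v + differential \<Sigma> m q v *\<^sub>R G q"
      by (rule differential_eq[OF has_derivative_scaleR[OF has_derivative_differential[OF m]
            has_derivative_differential[OF G]] v])
    finally show ?thesis .
  qed
  have qW: "q \<in> \<Sigma> \<inter> W" using q W by simp
  note Eq = ET[OF qW] and Fq = FT[OF qW]
  define P where "P = differential \<Sigma> F q (E q)"
  define Q where "Q = differential \<Sigma> E q (F q)"
  \<comment> \<open>The normal parts of \<open>P\<close> and \<open>Q\<close> vanish because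
    \<open>E q\<close> and \<open>F q\<close> are orthogonal eigenvectors. Hence
    \<open>P - Q\<close>, the Lie bracket of the two fields at \<open>q\<close>, is tangent.\<close>
  have P: "P \<in> tangent_space \<Sigma> q"
    using differential_tangent_field[OF q W F FT Eq] EF El[OF qW] q by (simp add: P_def tangent_space_eq)
  have Q: "Q \<in> tangent_space \<Sigma> q"
    using differential_tangent_field[OF q W E ET Fq] EF Fk[OF qW] q
    by (simp add: Q_def tangent_space_eq inner_commute)
  have PQ: "P - Q \<in> tangent_space \<Sigma> q" using P Q q by (simp add: tangent_space_eq inner_diff_right)
  have shape: "shape_operator \<Sigma> \<nu> q v = D q v" if "v \<in> tangent_space \<Sigma> q" for v
    using shape_operator_extension[OF U(1) _ N N\<nu> that] q U(2) by (simp add: D_def)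
  \<comment> \<open>This number is computed twice: here by symmetry of the shape operator, then from
    the differentiated eigenvalue equations. In the comparison the terms with \<open>P\<close>
    cancel.\<close>
  have "D q (P - Q) \<bullet> F q = shape_operator \<Sigma> \<nu> q (F q) \<bullet> (P - Q)"
    using shape_operator_symmetric[OF q PQ Fq] by (simp add: shape[OF PQ])
  then have 1: "D q (P - Q) \<bullet> F q = k q * (P \<bullet> F q - Q \<bullet> F q)"
    by (simp add: Fk[OF qW] inner_diff_right inner_commute)
  have "D q (P - Q) = D q P - D q Q"
    using linear_diff[OF linD[OF U(2)]] .
  also have "\<dots> = (k q *\<^sub>R P + differential \<Sigma> k q (E q) *\<^sub>R F q) - (l q *\<^sub>R Q + differential \<Sigma> l q (F q) *\<^sub>R E q)"
    using product[OF F k FT Fk Eq] product[OF E l ET El Fq] B_sym[of "F q" "E q"]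
    by (simp add: P_def Q_def)
  finally have "D q (P - Q) \<bullet> F q = k q * (P \<bullet> F q) + differential \<Sigma> k q (E q) * (F q \<bullet> F q) - l q * (Q \<bullet> F q)"
    using EF by (simp add: inner_diff_left inner_add_left)
  then show ?thesis
    using 1 by (simp add: Q_def[symmetric] algebra_simps)
qed

end

section \<open>Focal sheets\<close>

text \<open>One radius and its focal sheet; the theorem interprets it once for each of the two
  sheets.\<close>

locale focal_map_diffeomorphism = oriented_C3_hypersurface \<Sigma> \<nu>
  for \<Sigma> :: "'a::euclidean_space set" and \<nu> :: "'a \<Rightarrow> 'a" +
  fixes r :: "'a \<Rightarrow> real" and X Y :: "'a \<Rightarrow> 'a"
  assumes Y_def: "Y = (\<lambda>q. q - r q *\<^sub>R \<nu> q)"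
    and sheet: "Ck_hypersurface 2 (Y ` \<Sigma>)"
    and diffeo: "Ck_diffeomorphism 1 \<Sigma> (Y ` \<Sigma>) Y"
    and X_tangent: "\<And>q. q \<in> \<Sigma> \<Longrightarrow> X q \<in> tangent_space \<Sigma> q"
    and X_principal: "\<And>q. q \<in> \<Sigma> \<Longrightarrow> r q *\<^sub>R shape_operator \<Sigma> \<nu> q (X q) = X q"
    and dr_X: "\<And>q. q \<in> \<Sigma> \<Longrightarrow> differential \<Sigma> r q (X q) = 1"
begin

lemma Y_map: "Ck_map (Suc 0) \<Sigma> Y"
  using diffeo by (simp add: Ck_diffeomorphism_def)

lemma Y_differentiable: "q \<in> \<Sigma> \<Longrightarrow> Y differentiable (at q within \<Sigma>)"
  by (rule Ck_map_Suc_differentiable[OF Y_map])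

text \<open>The regularity of \<open>r\<close> is inherited from that of \<open>Y\<close> via \<open>r q = (q - Y q) \<bullet> \<nu> q\<close>.\<close>

lemma r_differentiable:
  assumes q: "q \<in> \<Sigma>"
  shows "r differentiable (at q within \<Sigma>)"
proof -
  have "((\<lambda>x. (x - Y x) \<bullet> \<nu> x) has_derivative
      (\<lambda>h. (q - Y q) \<bullet> differential \<Sigma> \<nu> q h + (h - differential \<Sigma> Y q h) \<bullet> \<nu> q)) (at q within \<Sigma>)"
    by (intro has_derivative_inner has_derivative_diff has_derivative_ident
        has_derivative_differential Y_differentiable normal_differentiable q)
  then have "(r has_derivative
      (\<lambda>h. (q - Y q) \<bullet> differential \<Sigma> \<nu> q h + (h - differential \<Sigma> Y q h) \<bullet> \<nu> q)) (at q within \<Sigma>)"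
    by (rule has_derivative_transform[OF q, rotated]) (simp add: Y_def)
  then show ?thesis by (rule differentiableI)
qed

lemma linear_differential_r: "q \<in> \<Sigma> \<Longrightarrow> linear (differential \<Sigma> r q)"
  using has_derivative_differential[OF r_differentiable] has_derivative_linear by blast

lemma linear_shape_operator: "q \<in> \<Sigma> \<Longrightarrow> linear (shape_operator \<Sigma> \<nu> q)"
  using has_derivative_differential[OF normal_differentiable] has_derivative_linear by blast

lemma X_nonzero: "q \<in> \<Sigma> \<Longrightarrow> X q \<noteq> 0"
  using dr_X[of q] linear_0[OF linear_differential_r[of q]] by auto

lemma r_nonzero: "q \<in> \<Sigma> \<Longrightarrow> r q \<noteq> 0"
  using X_nonzero[of q] X_principal[of q] by auto

lemma shape_operator_scaled:
  assumes "q \<in> \<Sigma>" and "r q *\<^sub>R shape_operator \<Sigma> \<nu> q w = w"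
  shows "shape_operator \<Sigma> \<nu> q w = (1 / r q) *\<^sub>R w"
  using r_nonzero[OF assms(1)] by (subst (2) assms(2)[symmetric]) simp

lemma differential_Y:
  assumes q: "q \<in> \<Sigma>" and w: "w \<in> tangent_space \<Sigma> q"
  shows "differential \<Sigma> Y q w = w - r q *\<^sub>R shape_operator \<Sigma> \<nu> q w - differential \<Sigma> r q w *\<^sub>R \<nu> q"
proof -
  have "(Y has_derivative (\<lambda>h. h - (r q *\<^sub>R differential \<Sigma> \<nu> q h + differential \<Sigma> r q h *\<^sub>R \<nu> q)))
      (at q within \<Sigma>)"
    unfolding Y_def
    by (intro has_derivative_diff has_derivative_ident has_derivative_scaleR
        has_derivative_differential r_differentiable normal_differentiable q)
  from differential_eq[OF this w] show ?thesis by simp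
qed

lemma differential_Y_X: "q \<in> \<Sigma> \<Longrightarrow> differential \<Sigma> Y q (X q) = - \<nu> q"
  by (simp add: differential_Y X_tangent X_principal dr_X)

text \<open>The difference of the two sides is again principal for \<open>r\<close>, and
  \<open>r\<close> has derivative 0 along it. So the differential of \<open>Y\<close> annihilates
  it, and that differential is injective.\<close>

lemma principal_direction_unique:
  assumes q: "q \<in> \<Sigma>" and w: "w \<in> tangent_space \<Sigma> q" and "r q *\<^sub>R shape_operator \<Sigma> \<nu> q w = w"
  shows "w = differential \<Sigma> r q w *\<^sub>R X q"
proof -
  let ?v = "w - differential \<Sigma> r q w *\<^sub>R X q"
  have v: "?v \<in> tangent_space \<Sigma> q"
    using w X_tangent[OF q] q by (simp add: tangent_space_eq inner_diff_right)
  have "r q *\<^sub>R shape_operator \<Sigma> \<nu> q (c *\<^sub>R X q) = c *\<^sub>R X q" for c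
    by (simp only: linear_cmul[OF linear_shape_operator[OF q]] scaleR_left_commute[of "r q"] X_principal[OF q])
  then have "r q *\<^sub>R shape_operator \<Sigma> \<nu> q ?v = ?v"
    by (simp only: linear_diff[OF linear_shape_operator[OF q]] scaleR_diff_right assms(3))
  moreover have "differential \<Sigma> r q ?v = 0"
    using dr_X[OF q] linear_diff[OF linear_differential_r[OF q]] linear_cmul[OF linear_differential_r[OF q]]
    by simp
  ultimately have "differential \<Sigma> Y q ?v = 0" by (simp add: differential_Y[OF q v])
  then have "?v = 0"
    using Ck_diffeomorphism_differential_inj[of 0, OF _ q v] diffeo by simp
  then show ?thesis by simp
qed

text \<open>The normal \<open>n\<close> is orthogonal to the image of the differential of
  \<open>Y\<close>. Testing with \<open>X q\<close> makes \<open>n\<close> tangent to the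
  hypersurface; testing with the defect \<open>?v\<close> of the eigenvalue equation shows that
  \<open>?v\<close> vanishes.\<close>

lemma sheet_normal_principal:
  assumes q: "q \<in> \<Sigma>" and tan: "tangent_space (Y ` \<Sigma>) (Y q) = {v. n \<bullet> v = 0}"
  shows "n \<in> tangent_space \<Sigma> q" and "r q *\<^sub>R shape_operator \<Sigma> \<nu> q n = n"
proof -
  have orth: "n \<bullet> differential \<Sigma> Y q w = 0" if "w \<in> tangent_space \<Sigma> q" for w
    using differential_in_tangent_space[OF Y_differentiable[OF q] _ that, of "Y ` \<Sigma>"] tan by auto
  have "n \<bullet> \<nu> q = 0"
    using orth[OF X_tangent[OF q]] by (simp add: differential_Y_X[OF q])
  then show n: "n \<in> tangent_space \<Sigma> q" using q by (simp add: tangent_space_eq inner_commute)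
  let ?v = "n - r q *\<^sub>R shape_operator \<Sigma> \<nu> q n"
  have v: "?v \<in> tangent_space \<Sigma> q"
    using n shape_operator_tangent[OF q n] q by (simp add: tangent_space_eq inner_diff_right)
  \<comment> \<open>The map sending \<open>w\<close> to
    \<open>w - r q *\<^sub>R shape_operator \<Sigma> \<nu> q w\<close> is symmetric, so it can be
    moved from \<open>n\<close> onto \<open>?v\<close>, where it is the tangential part of the
    differential of \<open>Y\<close>.\<close>
  have "?v \<bullet> ?v = n \<bullet> ?v - r q * (shape_operator \<Sigma> \<nu> q ?v \<bullet> n)"
    by (simp only: shape_operator_symmetric[OF q v n]) (simp add: inner_diff_left)
  also have "\<dots> = n \<bullet> differential \<Sigma> Y q ?v"
    using \<open>n \<bullet> \<nu> q = 0\<close> by (simp only: differential_Y[OF q v]) (simp add: inner_diff_right inner_commute)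
  finally show "r q *\<^sub>R shape_operator \<Sigma> \<nu> q n = n" using orth[OF v] by simp
qed

text \<open>The last two properties transfer the derivative of the sheet normal to its pullback by
  \<open>Y\<close>, so the second fundamental form of the sheet can be computed on the original
  hypersurface.\<close>

lemma sheet_normal:
  assumes q: "q \<in> \<Sigma>"
  obtains V N W where "open V" "Y q \<in> V" "Ck_on 1 V N" "\<And>x. x \<in> V \<Longrightarrow> norm (N x) = 1"
    "\<And>x. x \<in> (Y ` \<Sigma>) \<inter> V \<Longrightarrow> tangent_space (Y ` \<Sigma>) x = {v. N x \<bullet> v = 0}"
    "\<And>v w. v \<in> tangent_space (Y ` \<Sigma>) (Y q) \<Longrightarrow> w \<in> tangent_space (Y ` \<Sigma>) (Y q) \<Longrightarrow>
       frechet_derivative N (at (Y q)) v \<bullet> w = frechet_derivative N (at (Y q)) w \<bullet> v"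
    "open W" "q \<in> W" "\<And>x. x \<in> \<Sigma> \<inter> W \<Longrightarrow> Y x \<in> V"
    "(\<lambda>x. N (Y x)) differentiable (at q within \<Sigma>)"
    "\<And>v. v \<in> tangent_space \<Sigma> q \<Longrightarrow>
       frechet_derivative N (at (Y q)) (differential \<Sigma> Y q v) = differential \<Sigma> (\<lambda>x. N (Y x)) q v"
proof -
  have 2: "2 = Suc (Suc 0)" by simp
  obtain V N where V: "open V" "Y q \<in> V" and N: "Ck_on (Suc 0) V N"
    and unit: "\<And>x. x \<in> V \<Longrightarrow> norm (N x) = 1"
    and tan: "\<And>x. x \<in> (Y ` \<Sigma>) \<inter> V \<Longrightarrow> tangent_space (Y ` \<Sigma>) x = {v. N x \<bullet> v = 0}"
    and sym: "\<And>x v w. x \<in> (Y ` \<Sigma>) \<inter> V \<Longrightarrow> v \<in> tangent_space (Y ` \<Sigma>) x \<Longrightarrow> w \<in> tangent_space (Y ` \<Sigma>) x \<Longrightarrow>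
       frechet_derivative N (at x) v \<bullet> w = frechet_derivative N (at x) w \<bullet> v"
    by (fact Ck_hypersurface_unit_normal[OF sheet[unfolded 2] imageI[OF q]])
  have "continuous_on \<Sigma> Y"
    using Y_differentiable by (auto simp: continuous_on_eq_continuous_within intro: differentiable_imp_continuous_within)
  then obtain W where W: "open W" "\<Sigma> \<inter> Y -` V = \<Sigma> \<inter> W"
    using V(1) by (auto simp: continuous_on_open_invariant Int_commute)
  have "(N has_derivative frechet_derivative N (at (Y q))) (at (Y q))"
    by (rule Ck_on_Suc_has_derivative[OF N V(2)])
  then have N': "(N has_derivative frechet_derivative N (at (Y q))) (at (Y q) within Y ` \<Sigma>)"
    by (rule has_derivative_at_withinI)
  show ?thesis
  proof (rule that[OF V _ unit tan sym W(1)])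
    show "Ck_on 1 V N" using N by simp
    show "(\<lambda>x. N (Y x)) differentiable (at q within \<Sigma>)"
      using has_derivative_in_compose[OF has_derivative_differential[OF Y_differentiable[OF q]] N']
      by (rule differentiableI)
    show "frechet_derivative N (at (Y q)) (differential \<Sigma> Y q v) = differential \<Sigma> (\<lambda>x. N (Y x)) q v"
      if "v \<in> tangent_space \<Sigma> q" for v
      by (rule differential_compose[OF Y_differentiable[OF q] _ N' that, symmetric]) simp
  qed (use W(2) V(2) q in auto)
qed

end

theorem theorem2:
  fixes \<Sigma> :: "'a::euclidean_space set"
    and \<nu> :: "'a \<Rightarrow> 'a"
    and r :: "nat \<Rightarrow> 'a \<Rightarrow> real"
    and X :: "nat \<Rightarrow> 'a \<Rightarrow> 'a"
    and n :: nat
  assumes "DIM('a) = n + 1" and "n \<ge> 2"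
    and "Ck_hypersurface 3 \<Sigma>"
    and "unit_normal_field \<Sigma> \<nu>"
    and "strictly_convex_hypersurface \<Sigma> \<nu>"
    and "radii_of_curvature n \<Sigma> \<nu> r"
    and "multiplicity_one n \<Sigma> r"
    and "\<And>i. i \<in> {1, 2} \<Longrightarrow> Ck_hypersurface 2 (focal_sheet \<Sigma> \<nu> r i)"
    and "\<And>i. i \<in> {1, 2} \<Longrightarrow>
           Ck_diffeomorphism 1 \<Sigma> (focal_sheet \<Sigma> \<nu> r i) (focal_map \<nu> r i)"
    and "\<And>i q. i \<in> {1, 2} \<Longrightarrow> q \<in> \<Sigma> \<Longrightarrow> X i q \<in> tangent_space \<Sigma> q"
    and "\<And>i q. i \<in> {1, 2} \<Longrightarrow> q \<in> \<Sigma> \<Longrightarrow> r i q *\<^sub>R differential \<Sigma> \<nu> q (X i q) = X i q"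
    and "\<And>i q. i \<in> {1, 2} \<Longrightarrow> q \<in> \<Sigma> \<Longrightarrow> differential \<Sigma> (r i) q (X i q) = 1"
  shows "\<forall>q\<in>\<Sigma>.
    sectional_curvature (focal_sheet \<Sigma> \<nu> r 1) (focal_map \<nu> r 1 q)
      (differential \<Sigma> (focal_map \<nu> r 1) q (X 1 q))
      (differential \<Sigma> (focal_map \<nu> r 1) q (X 2 q))
    = (differential \<Sigma> (astigmatism r 1 2) q (X 1 q) - 1) / (astigmatism r 1 2 q)\<^sup>2"
proof
  fix q assume q: "q \<in> \<Sigma>"
  let ?Y = "\<lambda>i. focal_map \<nu> r i"
  have focal: "focal_map_diffeomorphism \<Sigma> \<nu> (r i) (X i) (?Y i)" if "i \<in> {1, 2}" for i
    using assms(3,4) assms(8-12)[OF that]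
    by unfold_locales (simp_all add: focal_map_def[abs_def] focal_sheet_def)
  interpret S1: focal_map_diffeomorphism \<Sigma> \<nu> "r 1" "X 1" "?Y 1" by (rule focal) simp
  interpret S2: focal_map_diffeomorphism \<Sigma> \<nu> "r 2" "X 2" "?Y 2" by (rule focal) simp

  \<comment> \<open>Unit principal fields from the sheet normals\<close>
  obtain V1 N1 W1 where V1: "open V1" "?Y 1 q \<in> V1" and N1: "Ck_on 1 V1 N1" "\<And>x. x \<in> V1 \<Longrightarrow> norm (N1 x) = 1"
    and tan1: "\<And>x. x \<in> (?Y 1 ` \<Sigma>) \<inter> V1 \<Longrightarrow> tangent_space (?Y 1 ` \<Sigma>) x = {v. N1 x \<bullet> v = 0}"
    and sym1: "\<And>v w. v \<in> tangent_space (?Y 1 ` \<Sigma>) (?Y 1 q) \<Longrightarrow> w \<in> tangent_space (?Y 1 ` \<Sigma>) (?Y 1 q) \<Longrightarrow>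
       frechet_derivative N1 (at (?Y 1 q)) v \<bullet> w = frechet_derivative N1 (at (?Y 1 q)) w \<bullet> v"
    and W1: "open W1" "q \<in> W1" "\<And>x. x \<in> \<Sigma> \<inter> W1 \<Longrightarrow> ?Y 1 x \<in> V1"
    and NY1: "(\<lambda>x. N1 (?Y 1 x)) differentiable (at q within \<Sigma>)"
      "\<And>v. v \<in> tangent_space \<Sigma> q \<Longrightarrow>
       frechet_derivative N1 (at (?Y 1 q)) (differential \<Sigma> (?Y 1) q v) = differential \<Sigma> (\<lambda>x. N1 (?Y 1 x)) q v"
    by (fact S1.sheet_normal[OF q])
  obtain V2 N2 W2 where V2: "open V2" "?Y 2 q \<in> V2" and N2: "Ck_on 1 V2 N2" "\<And>x. x \<in> V2 \<Longrightarrow> norm (N2 x) = 1"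
    and tan2: "\<And>x. x \<in> (?Y 2 ` \<Sigma>) \<inter> V2 \<Longrightarrow> tangent_space (?Y 2 ` \<Sigma>) x = {v. N2 x \<bullet> v = 0}"
    and "\<And>v w. v \<in> tangent_space (?Y 2 ` \<Sigma>) (?Y 2 q) \<Longrightarrow> w \<in> tangent_space (?Y 2 ` \<Sigma>) (?Y 2 q) \<Longrightarrow>
       frechet_derivative N2 (at (?Y 2 q)) v \<bullet> w = frechet_derivative N2 (at (?Y 2 q)) w \<bullet> v"
    and W2: "open W2" "q \<in> W2" "\<And>x. x \<in> \<Sigma> \<inter> W2 \<Longrightarrow> ?Y 2 x \<in> V2"
    and NY2: "(\<lambda>x. N2 (?Y 2 x)) differentiable (at q within \<Sigma>)"
      "\<And>v. v \<in> tangent_space \<Sigma> q \<Longrightarrow>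
       frechet_derivative N2 (at (?Y 2 q)) (differential \<Sigma> (?Y 2) q v) = differential \<Sigma> (\<lambda>x. N2 (?Y 2 x)) q v"
    by (fact S2.sheet_normal[OF q])
  define E where "E = (\<lambda>x. N1 (?Y 1 x))"
  define F where "F = (\<lambda>x. N2 (?Y 2 x))"
  define W where "W = W1 \<inter> W2"
  have W: "open W" "q \<in> W" using W1 W2 by (auto simp: W_def)
  have E: "norm (E x) = 1" "E x \<in> tangent_space \<Sigma> x" "r 1 x *\<^sub>R shape_operator \<Sigma> \<nu> x (E x) = E x"
    if "x \<in> \<Sigma> \<inter> W" for x
    using S1.sheet_normal_principal[OF _ tan1, of x] that W1(3)[of x] N1(2) by (auto simp: E_def W_def)
  have F: "norm (F x) = 1" "F x \<in> tangent_space \<Sigma> x" "r 2 x *\<^sub>R shape_operator \<Sigma> \<nu> x (F x) = F x"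
    if "x \<in> \<Sigma> \<inter> W" for x
    using S2.sheet_normal_principal[OF _ tan2, of x] that W2(3)[of x] N2(2) by (auto simp: F_def W_def)
  have qW: "q \<in> \<Sigma> \<inter> W" using q W by simp
  define r1 r2 where "r1 = r 1 q" and "r2 = r 2 q"
  define x y where "x = X 1 q" and "y = X 2 q"
  define S where "S = shape_operator \<Sigma> \<nu> q"
  define A where "A = frechet_derivative N1 (at (?Y 1 q))"
  define dE where "dE = differential \<Sigma> E q"
  \<comment> \<open>By \<open>principal_direction_unique\<close> these are the factors in
    \<open>E q = a *\<^sub>R x\<close> and \<open>F q = b *\<^sub>R y\<close>.\<close>
  define a b where "a = differential \<Sigma> (r 1) q (E q)" and "b = differential \<Sigma> (r 2) q (F q)"
  have r0: "r1 \<noteq> 0" "r2 \<noteq> 0" using S1.r_nonzero S2.r_nonzero q by (auto simp: r1_def r2_def)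
  have "1 \<in> {1..n}" "2 \<in> {1..n}" using assms(2) by auto
  then have r12: "r1 \<noteq> r2"
    using assms(7) q unfolding multiplicity_one_def r1_def r2_def by fastforce
  have xT: "x \<in> tangent_space \<Sigma> q" and yT: "y \<in> tangent_space \<Sigma> q"
    using S1.X_tangent S2.X_tangent q by (auto simp: x_def y_def)
  have Ex: "E q = a *\<^sub>R x" and Fy: "F q = b *\<^sub>R y"
    using S1.principal_direction_unique[OF q E(2,3)[OF qW]] S2.principal_direction_unique[OF q F(2,3)[OF qW]]
    by (simp_all add: a_def b_def x_def y_def)
  have EE: "E q \<bullet> E q = 1" and FF: "F q \<bullet> F q = 1"
    using E(1)[OF qW] F(1)[OF qW] by (simp_all add: norm_eq_1)
  then have ab: "a \<noteq> 0" "b \<noteq> 0" using Ex Fy by auto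
  have Sx: "S x = (1 / r1) *\<^sub>R x" and Sy: "S y = (1 / r2) *\<^sub>R y"
    using S1.shape_operator_scaled[OF q S1.X_principal[OF q]] S2.shape_operator_scaled[OF q S2.X_principal[OF q]]
    by (simp_all add: S_def x_def y_def r1_def r2_def)
  have "(1 / r1) * (x \<bullet> y) = (1 / r2) * (x \<bullet> y)"
    using S1.shape_operator_symmetric[OF q xT yT] Sx Sy unfolding S_def[symmetric] by (simp add: inner_commute)
  then have xy: "x \<bullet> y = 0" using r0 r12 by (auto simp: field_simps)
  have EF: "E q \<bullet> F q = 0" by (simp add: Ex Fy xy)
  have \<nu>T: "\<nu> q \<bullet> v = 0" if "v \<in> tangent_space \<Sigma> q" for v
    using that S1.tangent_space_eq[OF q] by simp
  have \<nu>dE: "\<nu> q \<bullet> dE v = - (S v \<bullet> E q)" if "v \<in> tangent_space \<Sigma> q" for v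
    using S1.differential_tangent_field[OF q W NY1(1)[folded E_def] E(2) that] by (simp add: dE_def S_def)
  have lin_dE: "linear dE"
    unfolding dE_def E_def by (rule has_derivative_linear[OF has_derivative_differential[OF NY1(1)]])

  \<comment> \<open>The Codazzi equation for the curvatures \<open>1 / r 1\<close> and
    \<open>1 / r 2\<close>\<close>
  have inv: "((\<lambda>x. 1 / r i x) has_derivative (\<lambda>h. - differential \<Sigma> (r i) q h / (r i q)\<^sup>2)) (at q within \<Sigma>)"
    if "r i q \<noteq> 0" "r i differentiable (at q within \<Sigma>)" for i
    using has_derivative_divide'[OF has_derivative_const[of 1] has_derivative_differential[OF that(2)] that(1)]
    by (simp add: power2_eq_square)
  have inv1: "(\<lambda>x. 1 / r 1 x) differentiable (at q within \<Sigma>)"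
    using inv[OF _ S1.r_differentiable[OF q]] r0 by (auto simp: r1_def intro: differentiableI)
  have inv2: "(\<lambda>x. 1 / r 2 x) differentiable (at q within \<Sigma>)"
    using inv[OF _ S2.r_differentiable[OF q]] r0 by (auto simp: r2_def intro: differentiableI)
  define \<rho> where "\<rho> = differential \<Sigma> (r 2) q x"
  \<comment> \<open>The factor by which the differential of the first focal map scales the
    tangential part of \<open>y\<close>; it also satisfies
    \<open>1 / r1 - 1 / r2 = k / r1\<close>.\<close>
  define k where "k = 1 - r1 / r2"
  have k0: "k \<noteq> 0" using r0 r12 by (simp add: k_def)
  have "differential \<Sigma> (\<lambda>x. 1 / r 2 x) q (E q) = - a * \<rho> / r2\<^sup>2"
    using differential_eq[OF inv[OF _ S2.r_differentiable[OF q]] E(2)[OF qW]] r0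
      linear_cmul[OF S2.linear_differential_r[OF q]]
    by (simp add: r2_def \<rho>_def Ex)
  moreover have "differential \<Sigma> (\<lambda>x. 1 / r 2 x) q (E q) * (F q \<bullet> F q)
      = (1 / r 1 q - 1 / r 2 q) * (differential \<Sigma> E q (F q) \<bullet> F q)"
  proof (rule S1.codazzi[OF q W _ _ inv1 inv2 E(2) F(2) _ _ EF])
    show "E differentiable (at q within \<Sigma>)" "F differentiable (at q within \<Sigma>)"
      using NY1(1) NY2(1) by (simp_all add: E_def F_def)
    show "shape_operator \<Sigma> \<nu> x (E x) = (1 / r 1 x) *\<^sub>R E x" if "x \<in> \<Sigma> \<inter> W" for x
      using S1.shape_operator_scaled[OF _ E(3)[OF that]] that by simp
    show "shape_operator \<Sigma> \<nu> x (F x) = (1 / r 2 x) *\<^sub>R F x" if "x \<in> \<Sigma> \<inter> W" for x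
      using S2.shape_operator_scaled[OF _ F(3)[OF that]] that by simp
  qed
  ultimately have "- a * \<rho> / r2\<^sup>2 = (1 / r1 - 1 / r2) * (b * b * (dE y \<bullet> y))"
    by (simp add: FF dE_def[symmetric] r1_def r2_def) (simp add: Fy linear_cmul[OF lin_dE])
  moreover have "1 / r1 - 1 / r2 = k / r1" using r0 by (simp add: k_def field_simps)
  ultimately have codazzi: "dE y \<bullet> y = - (a * \<rho> * r1) / (r2\<^sup>2 * b\<^sup>2 * k)"
    using ab k0 r0 by (simp add: field_simps power2_eq_square)

  \<comment> \<open>Second fundamental form and curvature of the first focal sheet\<close>
  define u v where "u = differential \<Sigma> (?Y 1) q x" and "v = differential \<Sigma> (?Y 1) q y"
  define m where "m = differential \<Sigma> (r 1) q y"
  have u: "u = - \<nu> q" using S1.differential_Y_X[OF q] by (simp add: u_def x_def)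
  have v: "v = k *\<^sub>R y - m *\<^sub>R \<nu> q"
    using S1.differential_Y[OF q yT] Sy unfolding S_def[symmetric]
    by (simp add: v_def k_def m_def r1_def scaleR_diff_left)
  have uvT: "u \<in> tangent_space (?Y 1 ` \<Sigma>) (?Y 1 q)" "v \<in> tangent_space (?Y 1 ` \<Sigma>) (?Y 1 q)"
    unfolding u_def v_def
    using differential_in_tangent_space[OF S1.Y_differentiable[OF q] order_refl] xT yT by blast+
  have A: "A u = dE x" "A v = dE y"
    using NY1(2)[OF xT] NY1(2)[OF yT] by (simp_all add: A_def dE_def E_def u_def v_def)
  have yy: "y \<bullet> y = 1 / b\<^sup>2" using FF ab by (simp add: Fy field_simps power2_eq_square)
  have xE: "x \<bullet> E q = 1 / a" using EE ab by (simp add: Ex field_simps)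
  have yE: "y \<bullet> E q = 0" using xy by (simp add: Ex inner_commute)
  \<comment> \<open>Products of \<open>dE\<close> with the normal reduce to the shape operator by
    \<open>\<nu>dE\<close>. The form is diagonal in \<open>u\<close> and \<open>v\<close>, and only
    its last entry needs the Codazzi equation.\<close>
  have Auu: "A u \<bullet> u = 1 / (a * r1)"
    using \<nu>dE[OF xT] xE unfolding A(1) by (simp add: u Sx inner_commute mult.commute)
  have Avu: "A v \<bullet> u = 0"
    using \<nu>dE[OF yT] yE unfolding A(2) by (simp add: u Sy inner_commute)
  have Auv: "A u \<bullet> v = 0"
    using sym1[OF uvT] Avu by (simp add: A_def)
  have Avv: "A v \<bullet> v = k * (dE y \<bullet> y)"
    using \<nu>dE[OF yT] yE unfolding A(2) by (subst v) (simp add: inner_diff_right inner_commute Sy)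
  \<comment> \<open>In the Gram determinant the square of \<open>m\<close> cancels, leaving
    \<open>k\<^sup>2 / b\<^sup>2\<close>.\<close>
  have "u \<bullet> u = 1" "u \<bullet> v = m" "v \<bullet> v = k\<^sup>2 / b\<^sup>2 + m\<^sup>2"
    using q \<nu>T[OF yT] yy
    by (simp_all add: u v inner_diff_right inner_diff_left inner_commute power2_eq_square)
  then have "sectional_curvature (focal_sheet \<Sigma> \<nu> r 1) (?Y 1 q) u v
      = (1 / (a * r1)) * (k * (dE y \<bullet> y)) / (k\<^sup>2 / b\<^sup>2)"
    using sectional_curvature_hypersurface[OF V1 imageI[OF q] N1 tan1 sym1 uvT, folded A_def]
    by (simp add: focal_sheet_def Auu Auv Avv)
  \<comment> \<open>The unknown lengths, encoded in \<open>a\<close> and \<open>b\<close>,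
    cancel.\<close>
  also have "\<dots> = - \<rho> / (r2\<^sup>2 * k\<^sup>2)"
    unfolding codazzi using ab k0 r0 by (simp add: field_simps power2_eq_square)
  also have "r2\<^sup>2 * k\<^sup>2 = (r1 - r2)\<^sup>2"
    using r0 by (simp add: k_def field_simps power2_eq_square)
  finally have "sectional_curvature (focal_sheet \<Sigma> \<nu> r 1) (?Y 1 q) u v = - \<rho> / (r1 - r2)\<^sup>2" .
  \<comment> \<open>The normalization of \<open>X 1\<close> contributes the 1, so
    \<open>- \<rho>\<close> is the numerator of the claim.\<close>
  moreover have "differential \<Sigma> (astigmatism r 1 2) q x = 1 - \<rho>"
    using differential_eq[OF has_derivative_diff[OF has_derivative_differential[OF S1.r_differentiable[OF q]]
          has_derivative_differential[OF S2.r_differentiable[OF q]]] xT] S1.dr_X[OF q]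
    by (simp add: astigmatism_def[abs_def] \<rho>_def x_def)
  ultimately show "sectional_curvature (focal_sheet \<Sigma> \<nu> r 1) (focal_map \<nu> r 1 q)
      (differential \<Sigma> (focal_map \<nu> r 1) q (X 1 q))
      (differential \<Sigma> (focal_map \<nu> r 1) q (X 2 q))
    = (differential \<Sigma> (astigmatism r 1 2) q (X 1 q) - 1) / (astigmatism r 1 2 q)\<^sup>2"
    by (simp add: u_def v_def x_def y_def astigmatism_def r1_def r2_def)
qed

end
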